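(* Let $P$ be a probability distribution on $\mathcal H$ satisfying a margin condition with radius $r_0>0$, let $\varepsilon>0$ be such that $P$ is $\varepsilon$-separated, and let $\delta=\frac{p_{min}B^2r_0^2}{64M^2}\wedge\varepsilon$. Let $\mathbf c^*\in\mathcal M$. For every $\mathbf c\in\mathcal H^k$ such that $R_{dist}(\mathbf c)-R_{dist}(\mathbf c^* )\le\delta$, $$R_{classif}\big(\mathcal C(\mathbf c),\mathcal C(\mathbf c^*(\mathbf c))\big)\le\frac{\sqrt{p_{min}}}{16M}\sqrt{R_{dist}(\mathbf c)-R_{dist}(\mathbf c^* )},$$ where $\mathbf c^*(\mathbf c)\in\arg\min_{\mathbf c'\in\mathcal M}\|\mathbf c-\mathbf c'\|$ is a closest optimal codebook to $\mathbf c$.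
   Context: $\mathcal H$ is a Hilbert space, $k\ge2$ a fixed integer, $M>0$. A codebook is $\mathbf c=(c_1,\dots,c_k)\in\mathcal H^k$, with $\|\mathbf c\|^2=\sum_j\|c_j\|^2$. For a distribution $P$ on $\mathcal H$, $R_{dist}(\mathbf c)=\int\min_{j}\|x-c_j\|^2\,P(dx)$. $\mathcal M$ is the set of minimizers of $R_{dist}$ over $\mathcal H^k$ (optimal codebooks). The support of $P$ is assumed to contain more than $k$ points. $P$ is $M$-bounded if its support is contained in the closed ball $\mathcal B(0,M)$; in that case $\mathcal M\ne\emptyset$. Voronoi cells: $V_j(\mathbf c)=\{x:\ \|x-c_j\|\le\|x-c_i\|\ \forall i\ne j\}$. Tessellation with ties broken: $W_1(\mathbf c)=V_1(\mathbf c)$, $W_j(\mathbf c)=V_j(\mathbf c)\setminus\bigcup_{i<j}W_i(\mathbf c)$. $B=\inf_{\mathbf c^*\in\mathcal M,\,i\ne j}\|c_i^*-c_j^*\|$ and $p_{min}=\inf_{\mathbf c^*\in\mathcal M,\,i}P(V_i(\mathbf c^* ))$; both are positive when $P$ is $M$-bounded. $N(\mathbf c^* )=\bigcup_{i\ne j}V_i(\mathbf c^* )\cap V_j(\mathbf c^* )$ is the boundary of the Voronoi diagram, and $\mathcal B(A,t)=\bigcup_{a\in A}\mathcal B(a,t)$, where $\mathcal B(a,t)$ is the closed ball. Margin condition: $P$ satisfies a margin condition with radius $r_0>0$ if $P$ is $M$-bounded and for all $0\le t\le r_0$, $p(t):=\sup_{\mathbf c^*\in\mathcal M}P(\mathcal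 B(N(\mathbf c^* ),t))\le\frac{B\,p_{min}}{128M^2}t$. Separation: let $\mathcal S$ be the set of codebooks $\mathbf c$ with $P(W_i(\mathbf c))c_i=\int x\mathbb 1_{W_i(\mathbf c)}(x)P(dx)$ for all $i=1,\dots,k$. For $\varepsilon>0$, $P$ is $\varepsilon$-separated if $\inf_{\mathbf c\in\mathcal S\setminus\mathcal M}R_{dist}(\mathbf c)-R_{dist}(\mathbf c^* )\ge\varepsilon$, where $\mathbf c^*\in\mathcal M$. (Under a margin condition such an $\varepsilon>0$ exists.) Classification: $\mathcal C(\mathbf c)$ is the partition of $\mathcal H$ into the $k$ Voronoi cells of $\mathbf c$, with ties arbitrarily broken. For two partitions $\mathcal C=(C_1,\dots,C_k)$ and $\mathcal C^*=(C_1^*,\dots,C_k^* )$ of $\mathcal H$, $R_{classif}(\mathcal C,\mathcal C^* )=\inf_{\sigma\in\mathcal S_k}P\left(\bigcup_{j=1}^kC_{\sigma(j)}\cap(C_j^* )^c\right)$, where $\mathcal S_k$ is the set of permutations of $\{1,\dots,k\}$.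
   Formalization: The codebook c is additionally assumed not to lie in S \ M; this excludes only non-optimal c in S with excess distortion exactly ε = δ, where the stated bound can fail (e.g. P uniform on {-1, s, 1}, small s, k = 2, ε equal to the infimum). *)

theory Defs
  imports "HOL-Analysis.Analysis" "HOL-Probability.Probability_Measure"
begin

definition support :: "'a::topological_space measure \<Rightarrow> 'a set" where
  "support P = {x. \<forall>U. open U \<longrightarrow> x \<in> U \<longrightarrow> emeasure P U > 0}"

(* The last conjunct says that P sits on its support. It is automatic in separable spaces
   (distribution_iff_separable below). In a non-separable Hilbert space it is what
   is needed for the norm integral of x over a cell to make sense at all: a Borel law
   is almost surely separably valued iff its support has full measure. *)
definition distribution :: "'a::topological_space measure \<Rightarrow> bool" where
  "distribution P \<longleftrightarrow> prob_space P \<and> sets P = sets borel \<and> emeasure P (support P) = 1"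

definition M_bounded :: "'a::real_normed_vector measure \<Rightarrow> real \<Rightarrow> bool" where
  "M_bounded P M \<longleftrightarrow> support P \<subseteq> cball 0 M"

(* Vector-valued integral in a Hilbert space that need not be separable; the library's
   Bochner integral requires a second countable codomain. The two agree wherever the
   latter applies (has_vec_integral_iff_bochner below). *)
definition has_vec_integral :: "'b measure \<Rightarrow> ('b \<Rightarrow> 'a::real_inner) \<Rightarrow> 'a \<Rightarrow> bool" where
  "has_vec_integral P f m \<longleftrightarrow>
     (\<forall>v. integrable P (\<lambda>x. f x \<bullet> v) \<and> (\<integral>x. f x \<bullet> v \<partial>P) = m \<bullet> v)"

(* A codebook of size k is a vector of type 'a ^ 'k with CARD('k) = k, so that norm is the
   codebook norm. The linear order on 'k plays the role of 1 < ... < k. *)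

definition R_dist :: "'a::real_inner measure \<Rightarrow> 'a ^ 'k \<Rightarrow> real" where
  "R_dist P c = (\<integral>x. (MIN j. (norm (x - c $ j))\<^sup>2) \<partial>P)"

definition optimal :: "'a::real_inner measure \<Rightarrow> ('a ^ 'k) set" where
  "optimal P = {c. \<forall>c' :: 'a ^ 'k. R_dist P c \<le> R_dist P c'}"

definition voronoi :: "'a::real_inner ^ 'k \<Rightarrow> 'k \<Rightarrow> 'a set" where
  "voronoi c j = {x. \<forall>i. i \<noteq> j \<longrightarrow> norm (x - c $ j) \<le> norm (x - c $ i)}"

function tessellation :: "'a::real_inner ^ 'k::{finite,linorder} \<Rightarrow> 'k \<Rightarrow> 'a set" where
  "tessellation c j = voronoi c j - (\<Union>i\<in>{..<j}. tessellation c i)"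
  by pat_completeness auto
termination
  by (relation "Wellfounded.measure (\<lambda>(c, j). card {..<j})") (auto intro!: psubset_card_mono)

declare tessellation.simps [simp del]

definition cell_sep :: "'k::finite itself \<Rightarrow> 'a::real_inner measure \<Rightarrow> real" where
  "cell_sep _ P = Inf {norm (c $ i - c $ j) | (c :: 'a ^ 'k) i j. c \<in> optimal P \<and> i \<noteq> j}"

definition p_min :: "'k::finite itself \<Rightarrow> 'a::real_inner measure \<Rightarrow> real" where
  "p_min _ P = Inf {measure P (voronoi c i) | (c :: 'a ^ 'k) i. c \<in> optimal P}"

definition boundary :: "'a::real_inner ^ 'k \<Rightarrow> 'a set" where
  "boundary c = (\<Union>i. \<Union>j\<in>- {i}. voronoi c i \<inter> voronoi c j)"

definition thickening :: "'a::metric_space set \<Rightarrow> real \<Rightarrow> 'a set" where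
  "thickening A t = (\<Union>a\<in>A. cball a t)"

definition margin_mass :: "'k::finite itself \<Rightarrow> 'a::real_inner measure \<Rightarrow> real \<Rightarrow> real" where
  "margin_mass _ P t =
     (SUP c \<in> (optimal P :: ('a ^ 'k) set). measure P (thickening (boundary c) t))"

definition margin_condition ::
    "'k::finite itself \<Rightarrow> 'a::real_inner measure \<Rightarrow> real \<Rightarrow> real \<Rightarrow> bool" where
  "margin_condition K P M r0 \<longleftrightarrow> r0 > 0 \<and> M_bounded P M \<and>
     (\<forall>t. 0 \<le> t \<and> t \<le> r0 \<longrightarrow>
        margin_mass K P t \<le> cell_sep K P * p_min K P / (128 * M\<^sup>2) * t)"

definition centroidal :: "'a::real_inner measure \<Rightarrow> ('a ^ 'k::{finite,linorder}) set" where
  "centroidal P = {c. \<forall>i. has_vec_integral P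
      (\<lambda>x. indicator (tessellation c i) x *\<^sub>R x) (measure P (tessellation c i) *\<^sub>R c $ i)}"

(* Extended reals, so that the infimum over an empty set is infinite. Since the inequality is
   not strict, \<epsilon> may equal the infimum, and a non-optimal centroidal codebook may then have
   excess distortion exactly \<epsilon>. *)
definition separated ::
    "'k::{finite,linorder} itself \<Rightarrow> 'a::real_inner measure \<Rightarrow> real \<Rightarrow> bool" where
  "separated _ P \<epsilon> \<longleftrightarrow> (\<forall>cs \<in> (optimal P :: ('a, 'k) vec set).
     (INF c \<in> centroidal P - (optimal P :: ('a, 'k) vec set). ereal (R_dist P c - R_dist P cs))
       \<ge> ereal \<epsilon>)"

(* C is a classification into the Voronoi cells of c, for some way of breaking ties;
   the pieces are measurable because their probabilities are taken. *)
definition voronoi_partition :: "'a::real_inner ^ 'k \<Rightarrow> ('k \<Rightarrow> 'a set) \<Rightarrow> bool" where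
  "voronoi_partition c C \<longleftrightarrow> disjoint_family C \<and> (\<Union>j. C j) = UNIV \<and>
     (\<forall>j. C j \<in> sets borel \<and> C j \<subseteq> voronoi c j)"

definition R_classif :: "'a measure \<Rightarrow> ('k \<Rightarrow> 'a set) \<Rightarrow> ('k \<Rightarrow> 'a set) \<Rightarrow> real" where
  "R_classif P C D = (INF \<sigma> \<in> {\<sigma>. \<sigma> permutes UNIV}. measure P (\<Union>j. C (\<sigma> j) \<inter> - D j))"

lemma closed_support: "closed (support P)"
proof -
  have "- support P = \<Union>{U. open U \<and> emeasure P U = 0}"
    unfolding support_def by (auto simp: not_gr_zero)
  then show ?thesis
    by (metis (mono_tags, lifting) closed_def mem_Collect_eq open_Union)
qed

lemma distribution_iff_separable:
  fixes P :: "'a::second_countable_topology measure"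
  shows "distribution P \<longleftrightarrow> prob_space P \<and> sets P = sets borel"
proof -
  have "emeasure P (support P) = 1" if P: "prob_space P" "sets P = sets borel"
  proof -
    interpret prob_space P by fact
    let ?F = "{U. open U \<and> emeasure P U = 0}"
    obtain F' where F': "F' \<subseteq> ?F" "countable F'" "\<Union>F' = \<Union>?F"
      using Lindelof[of ?F] by auto
    have "\<Union>F' \<in> null_sets P"
      using F' P(2) by (intro null_sets_UN'[where N="\<lambda>x. x", simplified]) (auto simp: null_sets_def)
    moreover have "- support P = \<Union>?F"
      unfolding support_def by (auto simp: not_gr_zero)
    ultimately have "AE x in P. x \<in> support P"
      using F'(3) by (intro AE_I[where N="\<Union>F'"]) (auto simp: null_sets_def)
    then show ?thesis
      using closed_support[of P] P(2) by (intro emeasure_eq_1_AE) auto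
  qed
  then show ?thesis by (auto simp: distribution_def)
qed

lemma has_vec_integral_iff_bochner:
  fixes f :: "'b \<Rightarrow> 'a::{real_inner,complete_space,second_countable_topology}"
  assumes "integrable P f"
  shows "has_vec_integral P f m \<longleftrightarrow> integral\<^sup>L P f = m"
proof -
  have "(\<forall>v. integral\<^sup>L P f \<bullet> v = m \<bullet> v) \<longleftrightarrow> integral\<^sup>L P f = m"
    by (metis vector_eq_rdot)
  with assms show ?thesis by (simp add: has_vec_integral_def)
qed

end

theory Submission
  imports Defs
begin

text \<open>Let r = B r0 / (4 sqrt 2 M) and let R* be the optimal distortion. Within distance r of an
  optimal codebook c*, a point of norm at most M that changes cells between c* and c lies within
  4 sqrt 2 M / B times the distance of c and c* of the boundary of c*, so the margin condition
  bounds the mass of such points linearly in that distance. This gives the classification bound,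
  and, compared with the distortion of c on the cells of c*, the quadratic lower bound
  R(c) - R* >= 11/16 pmin |c - c*|^2. The value of this bound on the sphere of radius r exceeds the
  allowed excess, so a Lloyd step, followed along a segment, cannot enter the r-balls from outside.
  By norm compactness of the set of partial means of P, the distortion therefore attains its
  infimum outside the balls once it is below the allowed excess somewhere there; the minimizer is
  a local minimizer, hence centroidal and not optimal, and separation rules this out.\<close>

section \<open>Voronoi cells and their boundary\<close>

text \<open>The obstacle is infinite dimension. Bounded minimizing sequences have only weak limits,
  and the complement of a ball is not weakly closed, so a weak limit could fall into one of the
  r-balls. Replacing codepoints by the centroids of their cells keeps the distortion from growing
  and moves the sequence into a norm compact set, because \<open>P\<close> is tight. The radius r is
  the distance at which the neighbourhood of width 4 sqrt 2 M / B times the distance reaches width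
  \<open>r0\<close>, the largest one that the margin condition controls. With this r the first term
  of the allowed excess is pmin r^2 / 2, strictly below the value 11/16 pmin r^2 on the
  spheres.\<close>

text \<open>The quadratic terms in \<open>x\<close> cancel, so the difference is affine in
  \<open>x\<close>: bisectors are hyperplanes, and comparisons of squared distances change linearly
  under shifts.\<close>

lemma norm_diff_sq_diff:
  fixes x a b :: "'a::real_inner"
  shows "(norm (x - a))\<^sup>2 - (norm (x - b))\<^sup>2 = (b - a) \<bullet> (2 *\<^sub>R x - a - b)"
  by (simp add: power2_norm_eq_inner algebra_simps inner_commute scaleR_2)

lemma norm_diff_sq_diff_le:
  fixes x a b :: "'a::real_inner"
  shows "\<bar>(norm (x - a))\<^sup>2 - (norm (x - b))\<^sup>2\<bar> \<le> norm (a - b) * (2 * norm x + norm a + norm b)"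
proof -
  have "\<bar>(b - a) \<bullet> (2 *\<^sub>R x - a - b)\<bar> \<le> norm (b - a) * norm (2 *\<^sub>R x - a - b)"
    by (rule Cauchy_Schwarz_ineq2)
  also have "\<dots> \<le> norm (b - a) * (2 * norm x + norm a + norm b)"
    by (intro mult_left_mono) (norm, simp)
  finally show ?thesis
    by (simp only: norm_diff_sq_diff norm_minus_commute[of a b])
qed

lemma norm_sq_shift_le:
  fixes x y a b :: "'a::real_inner"
  shows "(norm (x - a))\<^sup>2 - (norm (x - b))\<^sup>2
    \<le> (norm (y - a))\<^sup>2 - (norm (y - b))\<^sup>2 + 2 * norm (x - y) * norm (b - a)"
proof -
  have "(norm (x - a))\<^sup>2 - (norm (x - b))\<^sup>2 = (norm (y - a))\<^sup>2 - (norm (y - b))\<^sup>2 + 2 * ((b - a) \<bullet> (x - y))"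
    unfolding norm_diff_sq_diff by (simp add: algebra_simps inner_commute)
  moreover have "(b - a) \<bullet> (x - y) \<le> norm (x - y) * norm (b - a)"
    by (metis norm_cauchy_schwarz mult.commute)
  ultimately show ?thesis by simp
qed

text \<open>Converts estimates tested against every vector \<open>v\<close> into norm estimates, by
  the choice \<open>v = u\<close>.\<close>

lemma norm_le_of_inner_le:
  fixes u :: "'a::real_inner"
  assumes "u \<bullet> u \<le> e * norm u" "0 \<le> e"
  shows "norm u \<le> e"
  using assms by (cases "u = 0") (auto simp: power2_eq_square simp flip: power2_norm_eq_inner)

text \<open>Cauchy-Schwarz on two coordinates. A point that changes cells involves only two
  codepoints, whence a factor \<open>sqrt 2\<close> that does not grow with the number of
  cells.\<close>

lemma norm_add_components_le:
  fixes d :: "'a::real_normed_vector ^ 'k::finite"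
  assumes "i \<noteq> j"
  shows "norm (d $ i) + norm (d $ j) \<le> sqrt 2 * norm d"
proof -
  have "(norm (d $ i))\<^sup>2 + (norm (d $ j))\<^sup>2 = (\<Sum>l\<in>{i, j}. (norm (d $ l))\<^sup>2)"
    using assms by simp
  also have "\<dots> \<le> (\<Sum>l\<in>UNIV. (norm (d $ l))\<^sup>2)"
    by (rule sum_mono2) auto
  also have "\<dots> = (norm d)\<^sup>2"
    by (simp add: norm_vec_def L2_set_def sum_nonneg)
  finally have "(norm (d $ i) + norm (d $ j))\<^sup>2 \<le> (sqrt 2 * norm d)\<^sup>2"
    using sum_squares_bound[of "norm (d $ i)" "norm (d $ j)"]
    by (simp add: power2_sum power_mult_distrib)
  then show ?thesis
    by (rule power2_le_imp_le) simp
qed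

lemma closed_voronoi: "closed (voronoi c j)"
  unfolding voronoi_def
  by (intro closed_Collect_all closed_Collect_imp closed_Collect_le open_Collect_const continuous_intros)

lemma voronoi_sq_le: "x \<in> voronoi c i \<Longrightarrow> (norm (x - c $ i))\<^sup>2 \<le> (norm (x - c $ j))\<^sup>2"
  by (cases "i = j") (auto simp: voronoi_def intro: power_mono)

lemma voronoiI: "(\<And>j. (norm (x - c $ i))\<^sup>2 \<le> (norm (x - c $ j))\<^sup>2) \<Longrightarrow> x \<in> voronoi c i"
  by (auto simp: voronoi_def intro: power2_le_imp_le)

lemma ex_voronoi: "\<exists>i. x \<in> voronoi (c :: 'a::real_inner ^ 'k::finite) i"
proof -
  obtain i where "\<forall>j. norm (x - c $ i) \<le> norm (x - c $ j)"
    using ex_min_if_finite[of "range (\<lambda>j. norm (x - c $ j))"] by (auto simp: not_less)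
  then show ?thesis by (auto simp: voronoi_def)
qed

text \<open>From a point of cell i, the nearest boundary point is the orthogonal projection onto the
  nearest of the hyperplanes bisecting c i and c j, and this projection stays in cell i.\<close>

lemma ex_boundary_near:
  fixes c :: "'a::real_inner ^ 'k::finite"
  assumes x: "x \<in> voronoi c i" and j: "j \<noteq> i"
    and le: "(norm (x - c $ j))\<^sup>2 - (norm (x - c $ i))\<^sup>2 \<le> 2 * t * norm (c $ i - c $ j)"
    and t: "t \<ge> 0"
  shows "\<exists>a\<in>boundary c. dist a x \<le> t"
proof (cases "\<exists>l. l \<noteq> i \<and> c $ l = c $ i")
  \<comment> \<open>A codepoint equal to \<open>c $ i\<close> has no bisecting hyperplane; here all
    of cell \<open>i\<close> lies in the boundary, so \<open>x\<close> itself is the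
    witness.\<close>
  case True
  then obtain l where l: "l \<noteq> i" "c $ l = c $ i" by auto
  then have "x \<in> voronoi c l"
    using voronoi_sq_le[OF x] by (auto intro!: voronoiI)
  then have "x \<in> boundary c"
    using x l by (auto simp: boundary_def)
  then show ?thesis using t by (intro bexI[of _ x]) auto
next
  case False
  define h where "h l = (norm (x - c $ l))\<^sup>2 - (norm (x - c $ i))\<^sup>2" for l
  \<comment> \<open>\<open>q l\<close> is the distance from \<open>x\<close> to the hyperplane
    bisecting \<open>c $ i\<close> and \<open>c $ l\<close>.\<close>
  define q where "q l = h l / (2 * norm (c $ i - c $ l))" for l
  define l where "l = arg_min_on q (- {i})"
  have "finite (- {i})" "- {i} \<noteq> {}" using j by auto
  note am = arg_min_if_finite[OF this, of q, folded l_def]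
  have l: "l \<noteq> i" and q: "q l \<le> q m" if "m \<noteq> i" for m
    using am that by (force simp: not_less)+
  then have l: "l \<noteq> i" using j by auto
  have pos: "norm (c $ i - c $ m) > 0" if "m \<noteq> i" for m
    using False that by auto
  have "q j \<le> t"
    using le pos[OF j] by (simp add: q_def h_def field_simps)
  then have qt: "q l \<le> t" using q[OF j] by simp
  have hpos: "h m \<ge> 0" for m using voronoi_sq_le[OF x] by (simp add: h_def)
  then have q0: "q l \<ge> 0" by (simp add: q_def)
  define N where "N = norm (c $ i - c $ l)"
  define y where "y = x + (q l / N) *\<^sub>R (c $ l - c $ i)"
  have N: "N > 0" using pos l by (simp add: N_def)
  have dy: "norm (x - y) = q l"
    using N q0 by (simp add: y_def N_def norm_minus_commute)
  have hy: "(norm (y - c $ m))\<^sup>2 - (norm (y - c $ i))\<^sup>2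
      = h m - 2 * (q l / N) * ((c $ m - c $ i) \<bullet> (c $ l - c $ i))" for m
    unfolding h_def y_def norm_diff_sq_diff
    by (simp add: algebra_simps inner_commute)
  have NN: "(c $ l - c $ i) \<bullet> (c $ l - c $ i) = N * N"
    by (metis N_def norm_minus_commute power2_norm_eq_inner power2_eq_square)
  have "(norm (y - c $ l))\<^sup>2 - (norm (y - c $ i))\<^sup>2 = 0"
    unfolding hy NN using N by (simp add: q_def N_def)
  then have eq: "norm (y - c $ l) = norm (y - c $ i)" by simp
  \<comment> \<open>The move by \<open>q l\<close> lowers \<open>h m\<close> by at most
    \<open>2 * q l * norm (c $ i - c $ m)\<close>. Since \<open>q l\<close> is minimal this is at
    most \<open>h m\<close>, so no other bisector is crossed.\<close>
  have ge: "(norm (y - c $ i))\<^sup>2 \<le> (norm (y - c $ m))\<^sup>2" for m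
  proof (cases "m = i")
    case False
    have "(c $ m - c $ i) \<bullet> (c $ l - c $ i) \<le> norm (c $ i - c $ m) * N"
      unfolding N_def by (metis norm_cauchy_schwarz norm_minus_commute)
    then have "2 * (q l / N) * ((c $ m - c $ i) \<bullet> (c $ l - c $ i))
        \<le> 2 * (q l / N) * (norm (c $ i - c $ m) * N)"
      using q0 N by (intro mult_left_mono) auto
    also have "\<dots> = 2 * q l * norm (c $ i - c $ m)" using N by simp
    also have "\<dots> \<le> 2 * q m * norm (c $ i - c $ m)"
      using q[OF False] by (intro mult_right_mono) auto
    also have "\<dots> = h m" using pos[OF False] by (simp add: q_def)
    finally show ?thesis using hy[of m] by linarith
  qed simp
  have "y \<in> voronoi c i" by (rule voronoiI, rule ge)
  moreover have "y \<in> voronoi c l" by (rule voronoiI) (simp add: eq ge)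
  ultimately have "y \<in> boundary c" using l by (auto simp: boundary_def)
  then show ?thesis
    using dy qt by (intro bexI[of _ y]) (auto simp: dist_norm norm_minus_commute)
qed

text \<open>A union of closed balls around a closed set need not be closed in infinite dimension.
  The right-hand side is a finite union of sets cut out by continuous inequalities, which gives
  closedness, hence measurability, and a membership test free of projections.\<close>

lemma thickening_boundary_eq:
  fixes c :: "'a::real_inner ^ 'k::finite"
  assumes t: "t \<ge> 0"
  shows "thickening (boundary c) t = (\<Union>i. \<Union>j\<in>- {i}. {x \<in> voronoi c i.
    (norm (x - c $ j))\<^sup>2 - (norm (x - c $ i))\<^sup>2 \<le> 2 * t * norm (c $ i - c $ j)})" (is "_ = ?R")
proof
  show "?R \<subseteq> thickening (boundary c) t"
    using ex_boundary_near[OF _ _ _ t, of _ c] by (fastforce simp: thickening_def)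
next
  show "thickening (boundary c) t \<subseteq> ?R"
  proof
    fix x assume "x \<in> thickening (boundary c) t"
    then obtain a l m where a: "a \<in> voronoi c l" "a \<in> voronoi c m" "l \<noteq> m" "dist a x \<le> t"
      by (auto simp: thickening_def boundary_def)
    obtain i where i: "x \<in> voronoi c i" using ex_voronoi by blast
    obtain j where j: "j \<noteq> i" "a \<in> voronoi c j" using a by metis
    have "(norm (x - c $ j))\<^sup>2 - (norm (x - c $ i))\<^sup>2
        \<le> (norm (a - c $ j))\<^sup>2 - (norm (a - c $ i))\<^sup>2 + 2 * norm (x - a) * norm (c $ i - c $ j)"
      by (rule norm_sq_shift_le)
    also have "\<dots> \<le> 2 * norm (x - a) * norm (c $ i - c $ j)"
      using voronoi_sq_le[OF j(2)] by simp
    also have "\<dots> \<le> 2 * t * norm (c $ i - c $ j)"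
      using a(4) by (intro mult_right_mono) (auto simp: dist_norm norm_minus_commute)
    finally show "x \<in> ?R" using i j by blast
  qed
qed

lemma closed_thickening_boundary:
  fixes c :: "'a::real_inner ^ 'k::finite"
  assumes "t \<ge> 0"
  shows "closed (thickening (boundary c) t)"
  unfolding thickening_boundary_eq[OF assms] Collect_conj_eq Collect_mem_eq
  by (intro closed_UN ballI closed_Int closed_voronoi closed_Collect_le continuous_intros) auto

lemma thickening_0: "thickening A 0 = A"
  by (simp add: thickening_def)

text \<open>Each of the two codepoints shifts a squared distance by at most \<open>5 * M\<close>
  times its displacement, 5 being 2 + 2 + 1 from \<open>2 * norm x\<close>,
  \<open>norm (c $ l)\<close> and \<open>norm (d $ l)\<close>. The sum over the two displacements
  costs \<open>sqrt 2\<close>.\<close>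

lemma cell_change_le:
  fixes c d :: "'a::real_inner ^ 'k::finite"
  assumes "i \<noteq> j" "norm x \<le> M"
    and "\<And>l. norm (c $ l) \<le> 2 * M" "\<And>l. norm (d $ l) \<le> M"
  shows "((norm (x - c $ i))\<^sup>2 - (norm (x - c $ j))\<^sup>2) + ((norm (x - d $ j))\<^sup>2 - (norm (x - d $ i))\<^sup>2)
    \<le> 5 * sqrt 2 * M * norm (c - d)"
proof -
  have "0 \<le> M" using assms(2) norm_ge_zero order_trans by blast
  have *: "\<bar>(norm (x - c $ l))\<^sup>2 - (norm (x - d $ l))\<^sup>2\<bar> \<le> 5 * M * norm ((c - d) $ l)" for l
  proof -
    have "norm (c $ l - d $ l) * (2 * norm x + norm (c $ l) + norm (d $ l)) \<le> norm (c $ l - d $ l) * (5 * M)"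
      using assms(2) assms(3,4)[of l] by (intro mult_left_mono) auto
    then show ?thesis
      using norm_diff_sq_diff_le[of x "c $ l" "d $ l"] by (simp add: mult_ac)
  qed
  have "5 * M * (norm ((c - d) $ i) + norm ((c - d) $ j)) \<le> 5 * M * (sqrt 2 * norm (c - d))"
    using norm_add_components_le[OF assms(1), of "c - d"] \<open>0 \<le> M\<close> by (intro mult_left_mono) auto
  then show ?thesis
    using *[of i] *[of j] by (simp add: algebra_simps)
qed

lemma voronoi_partition_tessellation: "voronoi_partition c (tessellation c)"
proof -
  have sub: "tessellation c j \<subseteq> voronoi c j" for j
    by (subst tessellation.simps) auto
  have "tessellation c j \<in> sets borel" for j
  proof (induction c j rule: tessellation.induct)
    case (1 c j)
    then show ?case
      by (subst tessellation.simps) (intro sets.Diff sets.finite_UN borel_closed[OF closed_voronoi]; auto)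
  qed
  moreover have disj: "tessellation c i \<inter> tessellation c j = {}" if "i < j" for i j
    using that by (subst (2) tessellation.simps) auto
  have "tessellation c i \<inter> tessellation c j = {}" if "i \<noteq> j" for i j
    using that disj[of i j] disj[of j i] by (cases i j rule: linorder_cases) auto
  moreover have "x \<in> (\<Union>j. tessellation c j)" for x
  proof -
    obtain i where "x \<in> voronoi c i" using ex_voronoi by blast
    then show ?thesis using tessellation.simps[of c i] by auto
  qed
  ultimately show ?thesis
    using sub unfolding voronoi_partition_def disjoint_family_on_def by auto
qed

lemma voronoi_partition_cell:
  assumes "voronoi_partition c C"
  shows "\<exists>i. x \<in> C i \<and> x \<in> voronoi c i"
proof -
  have "x \<in> (\<Union>j. C j)" using assms by (simp add: voronoi_partition_def)
  then show ?thesis using assms by (auto simp: voronoi_partition_def)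
qed

lemma Min_voronoi:
  fixes c :: "'a::real_inner ^ 'k::finite"
  assumes "x \<in> voronoi c i"
  shows "(MIN j. (norm (x - c $ j))\<^sup>2) = (norm (x - c $ i))\<^sup>2"
  using voronoi_sq_le[OF assms] by (intro Min_eqI) auto

lemma sum_indicator_partition:
  fixes f :: "'k::finite \<Rightarrow> real"
  assumes "disjoint_family C" "x \<in> C i"
  shows "(\<Sum>j\<in>UNIV. indicator (C j) x * f j) = f i"
proof -
  have "(\<Sum>j\<in>UNIV. indicator (C j) x * f j) = (\<Sum>j\<in>UNIV. if j = i then f i else 0)"
    using assms by (intro sum.cong) (auto simp: disjoint_family_on_def indicator_def)
  then show ?thesis by simp
qed

section \<open>Distortion\<close>

locale bounded_distribution =
  fixes P :: "'a::{real_inner,complete_space} measure" and M :: real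
  assumes distribution: "distribution P" and bounded: "M_bounded P M"
begin

sublocale prob_space P
  using distribution by (simp add: distribution_def)

lemma sets_P [measurable_cong]: "sets P = sets borel"
  using distribution by (simp add: distribution_def)

lemma space_P [simp]: "space P = UNIV"
  using sets_eq_imp_space_eq[OF sets_P] by simp

lemma AE_support: "AE x in P. x \<in> support P"
  using distribution by (intro AE_prob_1) (simp add: distribution_def measure_def)

lemma AE_norm_le: "AE x in P. norm x \<le> M"
  using AE_support by eventually_elim (use bounded in \<open>auto simp: M_bounded_def\<close>)

lemma M_nonneg: "0 \<le> M"
proof -
  have "\<exists>x :: 'a. norm x \<le> M"
  proof (rule ccontr)
    assume "\<nexists>x :: 'a. norm x \<le> M"
    then show False using AE_norm_le by simp
  qed
  then show ?thesis using norm_ge_zero order_trans by blast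
qed

lemma integrable_bounded:
  fixes f :: "'a \<Rightarrow> real"
  assumes "f \<in> borel_measurable borel" "\<And>x. norm x \<le> M \<Longrightarrow> \<bar>f x\<bar> \<le> K"
  shows "integrable P f"
  using AE_norm_le assms
  by (intro integrable_const_bound[of _ K]) (auto elim!: AE_mp simp: measurable_cong_sets[OF sets_P refl])

lemma integrable_indicator_continuous:
  fixes f :: "'a \<Rightarrow> real"
  assumes "A \<in> sets borel" "continuous_on UNIV f" "\<And>x. norm x \<le> M \<Longrightarrow> \<bar>f x\<bar> \<le> K"
  shows "integrable P (\<lambda>x. indicator A x * f x)"
proof (rule integrable_bounded[of _ "\<bar>K\<bar>"])
  show "(\<lambda>x. indicator A x * f x) \<in> borel_measurable borel"
    using assms by (intro borel_measurable_times borel_measurable_indicator borel_measurable_continuous_onI)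
qed (use assms(3) in \<open>fastforce simp: indicator_def\<close>)

lemma integrable_indicator_inner:
  "A \<in> sets borel \<Longrightarrow> integrable P (\<lambda>x. indicator A x * (x \<bullet> v))"
  using M_nonneg
  by (intro integrable_indicator_continuous[of _ _ "M * norm v"] continuous_intros)
    (auto intro!: order_trans[OF Cauchy_Schwarz_ineq2] mult_right_mono)

lemma norm_diff_sq_le: "norm x \<le> M \<Longrightarrow> (norm (x - d))\<^sup>2 \<le> (M + norm d)\<^sup>2"
  by (intro power_mono) (norm, simp)

lemma integrable_indicator_sq:
  "A \<in> sets borel \<Longrightarrow> integrable P (\<lambda>x. indicator A x * (norm (x - d))\<^sup>2)"
  by (rule integrable_indicator_continuous[of _ _ "(M + norm d)\<^sup>2"])
    (auto intro!: continuous_intros norm_diff_sq_le)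

lemma integrable_Min:
  fixes c :: "'a ^ 'k::finite"
  shows "integrable P (\<lambda>x. MIN j. (norm (x - c $ j))\<^sup>2)"
proof -
  have Min: "\<exists>i. (MIN j. (norm (x - c $ j))\<^sup>2) = (norm (x - c $ i))\<^sup>2" for x
    using ex_voronoi[of x c] Min_voronoi[of x c] by blast
  show ?thesis
  proof (rule integrable_bounded[of _ "(M + norm c)\<^sup>2"])
    show "(\<lambda>x. MIN j. (norm (x - c $ j))\<^sup>2) \<in> borel_measurable borel"
      by (intro borel_measurable_Min borel_measurable_continuous_onI continuous_intros) auto
    fix x :: 'a assume x: "norm x \<le> M"
    obtain i where i: "(MIN j. (norm (x - c $ j))\<^sup>2) = (norm (x - c $ i))\<^sup>2"
      using Min by blast
    have "(norm (x - c $ i))\<^sup>2 \<le> (M + norm c)\<^sup>2"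
      using norm_diff_sq_le[OF x, of "c $ i"] Finite_Cartesian_Product.norm_nth_le[of c i] M_nonneg
      by (elim order_trans) (intro power_mono, auto)
    then show "\<bar>MIN j. (norm (x - c $ j))\<^sup>2\<bar> \<le> (M + norm c)\<^sup>2"
      by (simp add: i)
  qed
qed

text \<open>The assignment of points to cells is frozen to \<open>C\<close>. If \<open>C\<close>
  consists of the cells of \<open>c\<close>, this is a quadratic majorant of the distortion that
  touches it at \<open>c\<close>.\<close>

definition cost :: "('k::finite \<Rightarrow> 'a set) \<Rightarrow> 'a ^ 'k \<Rightarrow> real" where
  "cost C d = (\<Sum>i\<in>UNIV. \<integral>x. indicator (C i) x * (norm (x - d $ i))\<^sup>2 \<partial>P)"

lemma cost_eq_integral:
  assumes "voronoi_partition c C"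
  shows "cost C d = (\<integral>x. (\<Sum>i\<in>UNIV. indicator (C i) x * (norm (x - d $ i))\<^sup>2) \<partial>P)"
  unfolding cost_def using assms
  by (subst Bochner_Integration.integral_sum)
    (auto intro!: integrable_indicator_sq simp: voronoi_partition_def)

lemma integrable_cost:
  assumes "voronoi_partition c C"
  shows "integrable P (\<lambda>x. \<Sum>i\<in>UNIV. indicator (C i) x * (norm (x - d $ i))\<^sup>2)"
  using assms unfolding voronoi_partition_def
  by (intro Bochner_Integration.integrable_sum integrable_indicator_sq) simp

lemma R_dist_eq_cost:
  assumes "voronoi_partition c C"
  shows "R_dist P c = cost C c"
  unfolding cost_eq_integral[OF assms] R_dist_def
proof (rule Bochner_Integration.integral_cong[OF refl])
  fix x
  obtain i where "x \<in> C i" "x \<in> voronoi c i" "disjoint_family C"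
    using voronoi_partition_cell[OF assms, of x] assms unfolding voronoi_partition_def by blast
  then show "(MIN j. (norm (x - c $ j))\<^sup>2) = (\<Sum>i\<in>UNIV. indicator (C i) x * (norm (x - c $ i))\<^sup>2)"
    by (simp only: Min_voronoi sum_indicator_partition)
qed

lemma R_dist_le_cost:
  assumes "voronoi_partition c C"
  shows "R_dist P d \<le> cost C d"
  unfolding cost_eq_integral[OF assms] R_dist_def
proof (rule integral_mono[OF integrable_Min integrable_cost[OF assms]])
  fix x
  obtain i where "x \<in> C i" "disjoint_family C"
    using voronoi_partition_cell[OF assms, of x] assms unfolding voronoi_partition_def by blast
  then show "(MIN j. (norm (x - d $ j))\<^sup>2) \<le> (\<Sum>i\<in>UNIV. indicator (C i) x * (norm (x - d $ i))\<^sup>2)"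
    by (subst sum_indicator_partition) simp_all
qed

lemma R_dist_diff_le:
  fixes c d :: "'a ^ 'k::finite"
  assumes "\<And>x i. norm x \<le> M \<Longrightarrow> (norm (x - c $ i))\<^sup>2 - (norm (x - d $ i))\<^sup>2 \<le> K"
  shows "R_dist P c - R_dist P d \<le> K"
proof -
  have "R_dist P c \<le> (\<integral>x. (MIN j. (norm (x - d $ j))\<^sup>2) + K \<partial>P)"
    unfolding R_dist_def
  proof (rule integral_mono_AE)
    show "AE x in P. (MIN j. (norm (x - c $ j))\<^sup>2) \<le> (MIN j. (norm (x - d $ j))\<^sup>2) + K"
      using AE_norm_le
    proof eventually_elim
      fix x :: 'a assume x: "norm x \<le> M"
      obtain i where i: "x \<in> voronoi d i" using ex_voronoi by blast
      have "(MIN j. (norm (x - c $ j))\<^sup>2) \<le> (norm (x - c $ i))\<^sup>2" by simp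
      then show "(MIN j. (norm (x - c $ j))\<^sup>2) \<le> (MIN j. (norm (x - d $ j))\<^sup>2) + K"
        using assms[OF x, of i] Min_voronoi[OF i] by linarith
    qed
  qed (auto intro: integrable_Min)
  also have "\<dots> = R_dist P d + K"
    using prob_space by (simp add: R_dist_def integrable_Min)
  finally show ?thesis by simp
qed

lemma R_dist_lipschitz:
  fixes c d :: "'a ^ 'k::finite"
  shows "\<bar>R_dist P c - R_dist P d\<bar> \<le> norm (c - d) * (2 * M + norm c + norm d)"
proof -
  have *: "R_dist P c - R_dist P d \<le> norm (c - d) * (2 * M + norm c + norm d)" for c d :: "'a ^ 'k"
  proof (rule R_dist_diff_le)
    fix x :: 'a and i assume x: "norm x \<le> M"
    have "(norm (x - c $ i))\<^sup>2 - (norm (x - d $ i))\<^sup>2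
        \<le> norm (c $ i - d $ i) * (2 * norm x + norm (c $ i) + norm (d $ i))"
      using norm_diff_sq_diff_le[of x "c $ i" "d $ i"] by simp
    also have "\<dots> \<le> norm (c - d) * (2 * M + norm c + norm d)"
      using x Finite_Cartesian_Product.norm_nth_le[of "c - d" i] Finite_Cartesian_Product.norm_nth_le[of c i] Finite_Cartesian_Product.norm_nth_le[of d i]
      by (intro mult_mono) auto
    finally show "(norm (x - c $ i))\<^sup>2 - (norm (x - d $ i))\<^sup>2 \<le> norm (c - d) * (2 * M + norm c + norm d)" .
  qed
  show ?thesis using *[of c d] *[of d c] by (auto simp: norm_minus_commute algebra_simps abs_if)
qed

lemma continuous_R_dist: "continuous_on UNIV (R_dist P :: 'a ^ 'k::finite \<Rightarrow> real)"
proof -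
  have "(R_dist P \<longlongrightarrow> R_dist P c) (at c)" for c :: "'a ^ 'k"
  proof (rule Lim_transform2)
    have "((\<lambda>d. norm (c - d) * (2 * M + norm c + norm d)) \<longlongrightarrow> norm (c - c) * (2 * M + norm c + norm c)) (at c)"
      by (intro tendsto_intros)
    then have "((\<lambda>d. norm (c - d) * (2 * M + norm c + norm d)) \<longlongrightarrow> 0) (at c)"
      by simp
    then show "((\<lambda>d. R_dist P c - R_dist P d) \<longlongrightarrow> 0) (at c)"
      by (rule Lim_null_comparison[rotated])
        (auto intro!: always_eventually R_dist_lipschitz)
  qed simp
  then show ?thesis by (auto simp: continuous_on)
qed

lemma integral_sq_diff:
  assumes A: "A \<in> sets borel"
  shows "(\<integral>x. indicator A x * (norm (x - a))\<^sup>2 \<partial>P) - (\<integral>x. indicator A x * (norm (x - b))\<^sup>2 \<partial>P)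
    = 2 * (\<integral>x. indicator A x * (x \<bullet> (b - a)) \<partial>P) - measure P A * ((b - a) \<bullet> (b + a))"
proof -
  have "(\<integral>x. indicator A x * (norm (x - a))\<^sup>2 \<partial>P) - (\<integral>x. indicator A x * (norm (x - b))\<^sup>2 \<partial>P)
    = (\<integral>x. indicator A x * (norm (x - a))\<^sup>2 - indicator A x * (norm (x - b))\<^sup>2 \<partial>P)"
    using A by (simp add: integrable_indicator_sq)
  also have "\<dots> = (\<integral>x. 2 * (indicator A x * (x \<bullet> (b - a))) - indicator A x * ((b - a) \<bullet> (b + a)) \<partial>P)"
  proof (rule Bochner_Integration.integral_cong[OF refl])
    fix x
    have "(norm (x - a))\<^sup>2 - (norm (x - b))\<^sup>2 = 2 * (x \<bullet> (b - a)) - (b - a) \<bullet> (b + a)"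
      unfolding norm_diff_sq_diff by (simp add: algebra_simps inner_commute)
    then show "indicator A x * (norm (x - a))\<^sup>2 - indicator A x * (norm (x - b))\<^sup>2
      = 2 * (indicator A x * (x \<bullet> (b - a))) - indicator A x * ((b - a) \<bullet> (b + a))"
      by (simp add: indicator_def)
  qed
  also have "\<dots> = 2 * (\<integral>x. indicator A x * (x \<bullet> (b - a)) \<partial>P) - measure P A * ((b - a) \<bullet> (b + a))"
  proof -
    have "integrable P (indicator A :: 'a \<Rightarrow> real)"
      using A by (simp add: sets_P integrable_real_indicator emeasure_eq_measure)
    moreover have "(\<integral>x. indicator A x \<partial>P) = measure P A"
      using A by (simp add: sets_P)
    ultimately show ?thesis
      using A by (subst Bochner_Integration.integral_diff)
        (auto intro!: integrable_mult_right integrable_mult_left integrable_indicator_inner)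
  qed
  finally show ?thesis .
qed

text \<open>Huygens' identity: the cross term vanishes because \<open>m\<close> is the centroid.
  Writing the mean as \<open>measure P A *\<^sub>R m\<close> avoids a division and so includes cells
  of mass 0.\<close>

lemma centroid_cost:
  assumes A: "A \<in> sets borel"
    and m: "has_vec_integral P (\<lambda>x. indicator A x *\<^sub>R x) (measure P A *\<^sub>R m)"
  shows "(\<integral>x. indicator A x * (norm (x - d))\<^sup>2 \<partial>P)
    = (\<integral>x. indicator A x * (norm (x - m))\<^sup>2 \<partial>P) + measure P A * (norm (d - m))\<^sup>2"
proof -
  have "(\<integral>x. indicator A x * (x \<bullet> (m - d)) \<partial>P) = measure P A * (m \<bullet> (m - d))"
    using m by (simp add: has_vec_integral_def)
  then show ?thesis
    using integral_sq_diff[OF A, of d m]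
    by (simp add: power2_norm_eq_inner algebra_simps inner_commute)
qed

text \<open>The derivative of the distortion with the partition frozen vanishes at a local minimum.\<close>

lemma local_min_centroid:
  fixes c :: "'a ^ 'k::finite"
  assumes e: "e > 0" "\<And>d. norm (d - c) < e \<Longrightarrow> R_dist P c \<le> R_dist P d"
    and C: "voronoi_partition c C"
  shows "has_vec_integral P (\<lambda>x. indicator (C i) x *\<^sub>R x) (measure P (C i) *\<^sub>R c $ i)"
  unfolding has_vec_integral_def
proof (intro allI conjI)
  fix v
  have Ci: "C i \<in> sets borel" using C by (simp add: voronoi_partition_def)
  then show "integrable P (\<lambda>x. indicator (C i) x *\<^sub>R x \<bullet> v)"
    by (simp add: integrable_indicator_inner)
  define L where "L = (\<integral>x. indicator (C i) x * (x \<bullet> v) \<partial>P) - measure P (C i) * (c $ i \<bullet> v)"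
  define f where "f s = s\<^sup>2 * (measure P (C i) * (v \<bullet> v)) - 2 * s * L" for s
  \<comment> \<open>The denominator \<open>norm v + 1\<close> allows for
    \<open>v = 0\<close>.\<close>
  have "f 0 \<le> f s" if s: "\<bar>s\<bar> < e / (norm v + 1)" for s
  proof -
    define d where "d = c + axis i (s *\<^sub>R v)"
    have "norm (d - c) = \<bar>s\<bar> * norm v"
      by (simp add: d_def norm_vec_def L2_set_def axis_def if_distrib if_distribR cong: if_cong)
    also have "\<dots> \<le> \<bar>s\<bar> * (norm v + 1)" by (intro mult_left_mono) auto
    also have "\<dots> < e" using s by (simp add: pos_less_divide_eq add_nonneg_pos)
    finally have "R_dist P c \<le> R_dist P d" by (rule e(2))
    then have "0 \<le> cost C d - cost C c"
      using R_dist_le_cost[OF C, of d] R_dist_eq_cost[OF C] by simp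
    also have "\<dots> = (\<Sum>l\<in>UNIV. (\<integral>x. indicator (C l) x * (norm (x - d $ l))\<^sup>2 \<partial>P)
        - (\<integral>x. indicator (C l) x * (norm (x - c $ l))\<^sup>2 \<partial>P))"
      by (simp add: cost_def sum_subtractf)
    also have "\<dots> = (\<Sum>l\<in>UNIV. if l = i then (\<integral>x. indicator (C i) x * (norm (x - d $ i))\<^sup>2 \<partial>P)
        - (\<integral>x. indicator (C i) x * (norm (x - c $ i))\<^sup>2 \<partial>P) else 0)"
      by (intro sum.cong) (auto simp: d_def axis_def)
    also have "\<dots> = (\<integral>x. indicator (C i) x * (norm (x - d $ i))\<^sup>2 \<partial>P)
        - (\<integral>x. indicator (C i) x * (norm (x - c $ i))\<^sup>2 \<partial>P)"
      by simp
    also have "\<dots> = f s"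
      unfolding integral_sq_diff[OF Ci] f_def L_def
      by (simp add: d_def axis_def algebra_simps power2_eq_square inner_commute)
    finally show ?thesis by (simp add: f_def)
  qed
  moreover have "(f has_real_derivative - 2 * L) (at 0)"
    unfolding f_def by (auto intro!: derivative_eq_intros)
  ultimately have "- 2 * L = 0"
    using e(1) by (intro DERIV_local_min[of f _ 0 "e / (norm v + 1)"]) (auto simp: add_nonneg_pos)
  then show "(\<integral>x. indicator (C i) x *\<^sub>R x \<bullet> v \<partial>P) = measure P (C i) *\<^sub>R c $ i \<bullet> v"
    by (simp add: L_def)
qed

lemma optimal_centroid:
  assumes "c \<in> optimal P" "voronoi_partition c C"
  shows "has_vec_integral P (\<lambda>x. indicator (C i) x *\<^sub>R x) (measure P (C i) *\<^sub>R c $ i)"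
  using assms by (intro local_min_centroid[of 1]) (auto simp: optimal_def)

end

section \<open>Compactness of partial means\<close>

text \<open>Indices are treated one at a time by passing to further subsequences, under which the
  limits already obtained persist.\<close>

lemma finite_compact_subseq:
  fixes X :: "nat \<Rightarrow> 'k \<Rightarrow> 'b::metric_space"
  assumes "finite I" "compact K" "\<And>n i. i \<in> I \<Longrightarrow> X n i \<in> K"
  shows "\<exists>r l. strict_mono (r :: nat \<Rightarrow> nat) \<and> (\<forall>i\<in>I. (\<lambda>n. X (r n) i) \<longlonglongrightarrow> l i)"
  using assms(1,3)
proof (induction I rule: finite_induct)
  case empty
  have "strict_mono (\<lambda>n::nat. n)" by (simp add: strict_mono_def)
  then show ?case by (intro exI[of _ "\<lambda>n. n"]) simp
next
  case (insert j I)
  have "\<exists>r l. strict_mono (r :: nat \<Rightarrow> nat) \<and> (\<forall>i\<in>I. (\<lambda>n. X (r n) i) \<longlonglongrightarrow> l i)"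
    by (rule insert.IH) (use insert.prems in simp)
  then obtain r l where r: "strict_mono r" "\<forall>i\<in>I. (\<lambda>n. X (r n) i) \<longlonglongrightarrow> l i" by (elim exE conjE)
  have "\<forall>n. X (r n) j \<in> K" using insert.prems by simp
  then obtain y s where s: "strict_mono s" "((\<lambda>n. X (r n) j) \<circ> s) \<longlonglongrightarrow> y"
    using seq_compactE[OF compact_imp_seq_compact[OF assms(2)], of "\<lambda>n. X (r n) j"] by metis
  have "(\<lambda>n. X ((r \<circ> s) n) i) \<longlonglongrightarrow> (if i = j then y else l i)" if "i \<in> insert j I" for i
  proof (cases "i = j")
    case True
    then show ?thesis using s(2) by (simp add: o_def)
  next
    case False
    then have "((\<lambda>n. X (r n) i) \<circ> s) \<longlonglongrightarrow> l i"
      using that r(2) by (intro LIMSEQ_subseq_LIMSEQ s(1)) simp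
    then show ?thesis using False by (simp add: o_def)
  qed
  moreover have "strict_mono (r \<circ> s)" using r(1) s(1) by (rule strict_mono_o)
  ultimately show ?case
    by (intro exI[of _ "r \<circ> s"] exI[of _ "\<lambda>i. if i = j then y else l i"] conjI ballI)
qed

context bounded_distribution
begin

text \<open>The space may be non-separable, so countably many centres are extracted from a supremum:
  finite families whose balls of radius \<open>e / 2\<close> carry nearly the largest possible mass.
  A support point at distance at least \<open>e\<close> from all centres would have a ball of radius
  \<open>e / 2\<close> of positive mass disjoint from the others, and adding it would exceed the
  supremum.\<close>

lemma tight:
  assumes e: "e > 0"
  shows "\<exists>F. finite F \<and> prob (\<Union>a\<in>F. ball a e) > 1 - e"
proof -
  define U where "U F = (\<Union>a\<in>F. ball a (e / 2))" for F :: "'a set"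
  define s where "s = (SUP F\<in>Collect finite. prob (U F))"
  have U: "U F \<in> events" for F by (simp add: U_def sets_P borel_open open_UN)
  have bdd: "bdd_above ((\<lambda>F. prob (U F)) ` Collect finite)"
    by (intro bdd_aboveI[of _ 1]) auto
  have "\<exists>F. finite F \<and> s - 1 / Suc n < prob (U F)" for n
    using less_cSUP_iff[OF _ bdd, of "s - 1 / Suc n"] by (auto simp: s_def)
  then obtain F where F: "finite (F n)" "s - 1 / Suc n < prob (U (F n))" for n by metis
  define G where "G n = (\<Union>m\<le>n. F m)" for n
  have "support P \<subseteq> (\<Union>n. \<Union>a\<in>G n. ball a e)"
  proof (rule ccontr)
    assume "\<not> ?thesis"
    then obtain x where x: "x \<in> support P" "\<And>n a. a \<in> F n \<Longrightarrow> e \<le> dist a x"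
      by (force simp: G_def)
    have pos: "prob (ball x (e / 2)) > 0"
      using x(1) e by (auto simp: support_def emeasure_eq_measure)
    then obtain n where n: "1 / Suc n < prob (ball x (e / 2))"
      using nat_approx_posE by metis
    have "U (F n) \<inter> ball x (e / 2) = {}"
    proof (rule ccontr)
      assume "\<not> ?thesis"
      then obtain a y where "a \<in> F n" "dist a y < e / 2" "dist x y < e / 2" by (auto simp: U_def)
      then show False using x(2)[of a n] dist_triangle2[of a x y] by simp
    qed
    then have "prob (U (F n) \<union> ball x (e / 2)) = prob (U (F n)) + prob (ball x (e / 2))"
      using U by (intro finite_measure_Union) (auto simp: sets_P)
    moreover have "U (F n) \<union> ball x (e / 2) = U (insert x (F n))" by (auto simp: U_def)
    moreover have "prob (U (insert x (F n))) \<le> s"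
      unfolding s_def using F(1) by (intro cSUP_upper bdd) auto
    ultimately show False using F(2)[of n] n by simp
  qed
  then have "AE x in P. x \<in> (\<Union>n. \<Union>a\<in>G n. ball a e)"
    by (intro eventually_mono[OF AE_support]) blast
  then have "prob (\<Union>n. \<Union>a\<in>G n. ball a e) = 1"
    by (subst prob_eq_1) (simp_all add: sets_P borel_open open_UN)
  moreover have "(\<lambda>n. prob (\<Union>a\<in>G n. ball a e)) \<longlonglongrightarrow> prob (\<Union>n. \<Union>a\<in>G n. ball a e)"
  proof (rule finite_Lim_measure_incseq)
    show "range (\<lambda>n. \<Union>a\<in>G n. ball a e) \<subseteq> events"
      by (rule image_subsetI) (simp add: sets_P borel_open open_UN)
    have "G n \<subseteq> G (Suc n)" for n unfolding G_def by (intro UN_mono) auto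
    then show "incseq (\<lambda>n. \<Union>a\<in>G n. ball a e)"
      by (intro incseq_SucI UN_mono) auto
  qed
  ultimately have "\<forall>\<^sub>F n in sequentially. 1 - e < prob (\<Union>a\<in>G n. ball a e)"
    using e by (intro order_tendstoD) auto
  then obtain n where "1 - e < prob (\<Union>a\<in>G n. ball a e)"
    by (auto simp: eventually_sequentially)
  moreover have "finite (G n)" using F(1) by (simp add: G_def)
  ultimately show ?thesis by blast
qed

text \<open>By tightness, x is uniformly approximated by a simple function, so partial means lie
  up to e in the convex hull of a finite set that does not depend on the domain of integration.\<close>

lemma partial_mean_approx:
  assumes e: "e > 0"
  shows "\<exists>F. finite F \<and> (\<forall>W\<in>sets borel. \<exists>m\<in>convex hull F.
    \<forall>v. \<bar>(\<integral>x. indicator W x * (x \<bullet> v) \<partial>P) - m \<bullet> v\<bar> \<le> e * norm v)"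
proof -
  \<comment> \<open>The error is at most \<open>h\<close> on the covered part and at most
    \<open>M\<close> on a remainder of mass below \<open>h\<close>, per unit of
    \<open>norm v\<close>; together \<open>h * (1 + M) = e\<close>.\<close>
  define h where "h = e / (1 + M)"
  have h: "h > 0" using e M_nonneg by (simp add: h_def)
  have "h * (1 + M) = e" using M_nonneg by (simp add: h_def)
  then have eh: "e = h + M * h" by (simp add: distrib_left mult.commute)
  obtain F where F: "finite F" "prob (\<Union>a\<in>F. ball a h) > 1 - h"
    using tight[OF h] by blast
  obtain a :: "nat \<Rightarrow> 'a" and n where a: "F = a ` {i. i < n}"
    using finite_imp_nat_seg_image_inj_on[OF F(1)] by metis
  define A where "A = disjointed (\<lambda>i. ball (a i) h)"
  have disj: "disjoint_family A" by (simp add: A_def disjoint_family_disjointed)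
  have A: "A i \<in> sets borel" for i
    unfolding A_def disjointed_def by (intro sets.Diff sets.finite_UN borel_open open_ball) auto
  have near: "dist (a i) x \<le> h" if "x \<in> A i" for i x
    using that by (simp add: A_def disjointed_def)
  define N where "N = - (\<Union>i<n. A i)"
  have N: "N \<in> sets borel" unfolding N_def using A by (intro borel_comp sets.finite_UN) auto
  have "(\<Union>i<n. A i) = (\<Union>i<n. ball (a i) h)"
    using finite_UN_disjointed_eq[of "\<lambda>i. ball (a i) h" n] by (simp only: A_def atLeast0LessThan)
  also have "\<dots> = (\<Union>a\<in>F. ball a h)" by (simp add: a lessThan_def)
  finally have "prob (\<Union>i<n. A i) > 1 - h" using F(2) by simp
  moreover have "prob (UNIV - (\<Union>i<n. A i)) = 1 - prob (\<Union>i<n. A i)"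
    using A prob_compl[of "\<Union>i<n. A i"] by (simp add: sets_P)
  ultimately have "prob N < h" by (simp add: N_def Compl_eq_Diff_UNIV)
  have "\<exists>m\<in>convex hull (insert 0 F). \<forall>v. \<bar>(\<integral>x. indicator W x * (x \<bullet> v) \<partial>P) - m \<bullet> v\<bar> \<le> e * norm v"
    if W: "W \<in> sets borel" for W
  proof (intro bexI allI)
    define m where "m = (\<Sum>i<n. prob (W \<inter> A i) *\<^sub>R a i)"
    have "(\<Sum>i<n. prob (W \<inter> A i)) = prob (\<Union>i<n. W \<inter> A i)"
      using W A disj by (intro finite_measure_finite_Union[symmetric])
        (auto simp: sets_P disjoint_family_on_def)
    then have sum1: "(\<Sum>i<n. prob (W \<inter> A i)) \<le> 1" by simp
    \<comment> \<open>The weights \<open>prob (W \<inter> A i)\<close> add up to at most 1; the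
      missing weight is placed at the extra point 0, which makes the combination convex.\<close>
    have "(\<Sum>i<Suc n. (if i < n then prob (W \<inter> A i) else 1 - (\<Sum>i<n. prob (W \<inter> A i)))
        *\<^sub>R (if i < n then a i else 0)) \<in> convex hull (insert 0 F)"
      using sum1 by (intro convex_sum convex_convex_hull hull_inc) (simp_all add: a)
    then show "m \<in> convex hull (insert 0 F)" by (simp add: m_def)
    fix v
    define f where "f x = indicator W x * (x \<bullet> v) - (\<Sum>i<n. indicator (W \<inter> A i) x * (a i \<bullet> v))" for x
    have intA: "integrable P (\<lambda>x. indicator (W \<inter> A i) x * (a i \<bullet> v))" for i
      using W A by (intro integrable_mult_left integrable_real_indicator)
        (auto simp: sets_P emeasure_eq_measure)
    have "(\<integral>x. indicator (W \<inter> A i) x * (a i \<bullet> v) \<partial>P) = prob (W \<inter> A i) * (a i \<bullet> v)" for i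
      using W A[of i] by (simp add: sets_P)
    then have f: "(\<integral>x. f x \<partial>P) = (\<integral>x. indicator W x * (x \<bullet> v) \<partial>P) - m \<bullet> v"
      unfolding f_def m_def inner_sum_left inner_scaleR_left
      by (subst Bochner_Integration.integral_diff[OF integrable_indicator_inner[OF W]
            Bochner_Integration.integrable_sum[OF intA]])
        (simp only: Bochner_Integration.integral_sum[OF intA])
    have "\<bar>\<integral>x. f x \<partial>P\<bar> \<le> (\<integral>x. h * norm v + M * norm v * indicator N x \<partial>P)"
    proof (rule integral_abs_bound[THEN order_trans], rule integral_mono_AE)
      show "integrable P (\<lambda>x. \<bar>f x\<bar>)"
        unfolding f_def
        by (intro integrable_abs Bochner_Integration.integrable_diff Bochner_Integration.integrable_sum
            integrable_indicator_inner W intA)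
      show "integrable P (\<lambda>x. h * norm v + M * norm v * indicator N x)"
        using N by (intro Bochner_Integration.integrable_add integrable_mult_right integrable_real_indicator)
          (auto simp: sets_P emeasure_eq_measure)
      show "AE x in P. \<bar>f x\<bar> \<le> h * norm v + M * norm v * indicator N x"
        using AE_norm_le
      proof eventually_elim
        fix x :: 'a assume x: "norm x \<le> M"
        show "\<bar>f x\<bar> \<le> h * norm v + M * norm v * indicator N x"
        proof (cases "x \<in> N")
          case True
          then have "f x = indicator W x * (x \<bullet> v)" by (simp add: f_def N_def)
          also have "\<bar>\<dots>\<bar> \<le> norm x * norm v"
            by (simp add: indicator_def Cauchy_Schwarz_ineq2)
          also have "\<dots> \<le> M * norm v" using x by (intro mult_right_mono) auto
          finally show ?thesis using True h by (simp add: add_increasing)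
        next
          case False
          then obtain j where j: "j < n" "x \<in> A j" by (auto simp: N_def)
          have "(\<Sum>i<n. indicator (W \<inter> A i) x * (a i \<bullet> v))
              = (\<Sum>i<n. if i = j then indicator W x * (a j \<bullet> v) else 0)"
            using disj j by (intro sum.cong) (auto simp: disjoint_family_on_def indicator_def)
          then have "f x = indicator W x * ((x - a j) \<bullet> v)"
            using j by (simp add: f_def algebra_simps)
          also have "\<bar>\<dots>\<bar> \<le> norm (x - a j) * norm v"
            by (simp add: indicator_def Cauchy_Schwarz_ineq2)
          also have "\<dots> \<le> h * norm v"
            using near[OF j(2)] by (intro mult_right_mono) (auto simp: dist_norm norm_minus_commute)
          finally show ?thesis using False by simp
        qed
      qed
    qed
    also have "\<dots> = h * norm v + M * norm v * prob N"
      using N prob_space by (subst Bochner_Integration.integral_add)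
        (auto simp: sets_P emeasure_eq_measure intro!: integrable_mult_right integrable_real_indicator)
    also have "\<dots> \<le> h * norm v + M * norm v * h"
      using \<open>prob N < h\<close> M_nonneg by (intro add_left_mono mult_left_mono) auto
    also have "\<dots> = e * norm v" by (simp add: eh algebra_simps)
    finally show "\<bar>(\<integral>x. indicator W x * (x \<bullet> v) \<partial>P) - m \<bullet> v\<bar> \<le> e * norm v" by (simp add: f)
  qed
  then show ?thesis using F(1) by (intro exI[of _ "insert 0 F"]) auto
qed

text \<open>A representing vector in the sense of Riesz: vectors that represent the functional up to
  \<open>1 / Suc n\<close> differ pairwise by at most the sum of their errors, so they form a Cauchy
  sequence, and completeness supplies the mean.\<close>

lemma ex_partial_mean:
  assumes W: "W \<in> sets borel"
  shows "\<exists>m. has_vec_integral P (\<lambda>x. indicator W x *\<^sub>R x) m"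
proof -
  define I where "I v = (\<integral>x. indicator W x * (x \<bullet> v) \<partial>P)" for v
  have "\<exists>m. \<forall>v. \<bar>I v - m \<bullet> v\<bar> \<le> 1 / Suc n * norm v" for n
  proof -
    obtain F where "\<forall>W\<in>sets borel. \<exists>m\<in>convex hull F.
        \<forall>v. \<bar>(\<integral>x. indicator W x * (x \<bullet> v) \<partial>P) - m \<bullet> v\<bar> \<le> 1 / Suc n * norm v"
      using partial_mean_approx[of "1 / Suc n"] zero_less_divide_1_iff of_nat_0_less_iff zero_less_Suc by metis
    from bspec[OF this W] show ?thesis unfolding I_def by (elim bexE) (rule exI)
  qed
  then have "\<exists>m. \<forall>n. \<forall>v. \<bar>I v - m n \<bullet> v\<bar> \<le> 1 / Suc n * norm v" by (intro choice allI)
  then obtain m where m0: "\<forall>n. \<forall>v. \<bar>I v - m n \<bullet> v\<bar> \<le> 1 / Suc n * norm v" ..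
  note m = m0[rule_format]
  have d: "dist (m i) (m j) \<le> 1 / Suc i + 1 / Suc j" for i j
    unfolding dist_norm
  proof (rule norm_le_of_inner_le)
    have "(m i - m j) \<bullet> (m i - m j) = (I (m i - m j) - m j \<bullet> (m i - m j)) - (I (m i - m j) - m i \<bullet> (m i - m j))"
      by (simp add: inner_diff_left)
    also have "\<dots> \<le> 1 / Suc j * norm (m i - m j) + 1 / Suc i * norm (m i - m j)"
      using m[of "m i - m j" i] m[of "m i - m j" j] by linarith
    finally show "(m i - m j) \<bullet> (m i - m j) \<le> (1 / Suc i + 1 / Suc j) * norm (m i - m j)"
      by (simp only: distrib_right add.commute)
    show "0 \<le> 1 / real (Suc i) + 1 / real (Suc j)" by simp
  qed
  have "Cauchy m"
  proof (rule metric_CauchyI)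
    fix e :: real assume "e > 0"
    then obtain N where N: "1 / Suc N < e / 2" using nat_approx_posE[of "e / 2"] by auto
    have "dist (m i) (m j) < e" if "N \<le> i" "N \<le> j" for i j
    proof -
      have "1 / Suc i \<le> 1 / Suc N" "1 / Suc j \<le> 1 / Suc N"
        using that by (auto intro!: divide_left_mono)
      then show ?thesis using d[of i j] N by linarith
    qed
    then show "\<exists>N. \<forall>i\<ge>N. \<forall>j\<ge>N. dist (m i) (m j) < e" by blast
  qed
  then obtain l where l: "m \<longlonglongrightarrow> l"
    using Cauchy_convergent convergent_def by blast
  have "I v = l \<bullet> v" for v
  proof -
    have "(\<lambda>n. I v - m n \<bullet> v) \<longlonglongrightarrow> I v - l \<bullet> v"
      by (rule tendsto_diff[OF tendsto_const tendsto_inner[OF l tendsto_const]])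
    moreover have "(\<lambda>n. I v - m n \<bullet> v) \<longlonglongrightarrow> 0"
    proof (rule Lim_null_comparison)
      show "(\<lambda>n. inverse (real (Suc n)) * norm v) \<longlonglongrightarrow> 0"
        by (rule tendsto_mult_left_zero[OF LIMSEQ_inverse_real_of_nat])
      show "\<forall>\<^sub>F n in sequentially. norm (I v - m n \<bullet> v) \<le> inverse (real (Suc n)) * norm v"
      proof (rule always_eventually, rule allI)
        fix n show "norm (I v - m n \<bullet> v) \<le> inverse (real (Suc n)) * norm v"
          using m[of v n] by (simp only: real_norm_def inverse_eq_divide)
      qed
    qed
    ultimately have "I v - l \<bullet> v = 0" by (rule LIMSEQ_unique)
    then show ?thesis by simp
  qed
  then have "has_vec_integral P (\<lambda>x. indicator W x *\<^sub>R x) l"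
    using integrable_indicator_inner[OF W] by (simp add: has_vec_integral_def I_def)
  then show ?thesis ..
qed

text \<open>Total boundedness comes from the compact convex hull of a finite set that serves all
  domains \<open>W\<close> at once.\<close>

lemma compact_partial_means:
  "compact (closure {m. \<exists>W\<in>sets borel. has_vec_integral P (\<lambda>x. indicator W x *\<^sub>R x) m})"
  (is "compact (closure ?S)")
  unfolding compact_eq_totally_bounded
proof (intro conjI allI impI)
  show "complete (closure ?S)" by (simp add: complete_eq_closed)
  fix e :: real assume e: "e > 0"
  obtain F where F: "finite F" "\<And>W. W \<in> sets borel \<Longrightarrow> \<exists>m\<in>convex hull F.
    \<forall>v. \<bar>(\<integral>x. indicator W x * (x \<bullet> v) \<partial>P) - m \<bullet> v\<bar> \<le> e / 3 * norm v"
    using partial_mean_approx[of "e / 3"] e by auto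
  have "compact (convex hull F)" by (rule finite_imp_compact_convex_hull[OF F(1)])
  then obtain k where k: "finite k" "convex hull F \<subseteq> (\<Union>x\<in>k. ball x (e / 3))"
    using e unfolding compact_eq_totally_bounded by (meson divide_pos_pos zero_less_numeral)
  \<comment> \<open>\<open>e / 3\<close> for the distance to the hull and \<open>e / 3\<close> for
    the net of the hull. Closed balls let the inclusion pass to the closure, and the remaining
    \<open>e / 3\<close> makes the balls open again.\<close>
  have "?S \<subseteq> (\<Union>x\<in>k. cball x (2 * e / 3))"
  proof
    fix u assume "u \<in> ?S"
    then obtain W where W: "W \<in> sets borel" "has_vec_integral P (\<lambda>x. indicator W x *\<^sub>R x) u" by auto
    then obtain m where m: "m \<in> convex hull F" "\<And>v. \<bar>u \<bullet> v - m \<bullet> v\<bar> \<le> e / 3 * norm v"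
      using F(2)[of W] by (auto simp: has_vec_integral_def)
    have "norm (u - m) \<le> e / 3"
      using order_trans[OF abs_ge_self m(2)[of "u - m"]] e
      by (intro norm_le_of_inner_le) (simp_all add: inner_diff_left)
    moreover obtain x where "x \<in> k" "dist x m < e / 3" using k m(1) by auto
    ultimately show "u \<in> (\<Union>x\<in>k. cball x (2 * e / 3))"
      using dist_triangle2[of x u m] by (auto simp: dist_norm norm_minus_commute intro!: bexI[of _ x])
  qed
  then have "closure ?S \<subseteq> (\<Union>x\<in>k. cball x (2 * e / 3))"
    using k(1) by (intro closure_minimal closed_UN) auto
  also have "\<dots> \<subseteq> (\<Union>x\<in>k. ball x e)" using e by (intro UN_mono) auto
  finally show "\<exists>k. finite k \<and> closure ?S \<subseteq> (\<Union>x\<in>k. ball x e)" using k(1) by blast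
qed

end

section \<open>Existence of minimizers outside the balls\<close>

lemma norm_sq_convex:
  fixes u w :: "'a::real_inner"
  assumes "0 \<le> s" "s \<le> 1"
  shows "(norm ((1 - s) *\<^sub>R u + s *\<^sub>R w))\<^sup>2 \<le> (1 - s) * (norm u)\<^sup>2 + s * (norm w)\<^sup>2"
proof -
  have "(1 - s) * (norm u)\<^sup>2 + s * (norm w)\<^sup>2 - (norm ((1 - s) *\<^sub>R u + s *\<^sub>R w))\<^sup>2
      = s * (1 - s) * (norm (u - w))\<^sup>2"
    by (simp add: power2_norm_eq_inner algebra_simps inner_commute)
  also have "\<dots> \<ge> 0" using assms by simp
  finally show ?thesis by simp
qed

context bounded_distribution
begin

lemma R_dist_nonneg:
  fixes c :: "'a ^ 'k::finite"
  shows "0 \<le> R_dist P c"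
  unfolding R_dist_def by (intro Bochner_Integration.integral_nonneg) simp

lemma cost_convex:
  fixes c d :: "'a ^ 'k::finite"
  assumes s: "0 \<le> s" "s \<le> 1" and C: "\<And>i. C i \<in> sets borel"
  shows "cost C ((1 - s) *\<^sub>R c + s *\<^sub>R d) \<le> (1 - s) * cost C c + s * cost C d"
proof -
  have "(\<integral>x. indicator (C i) x * (norm (x - ((1 - s) *\<^sub>R c + s *\<^sub>R d) $ i))\<^sup>2 \<partial>P)
      \<le> (1 - s) * (\<integral>x. indicator (C i) x * (norm (x - c $ i))\<^sup>2 \<partial>P)
        + s * (\<integral>x. indicator (C i) x * (norm (x - d $ i))\<^sup>2 \<partial>P)" for i
  proof -
    have "(\<integral>x. indicator (C i) x * (norm (x - ((1 - s) *\<^sub>R c + s *\<^sub>R d) $ i))\<^sup>2 \<partial>P)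
      \<le> (\<integral>x. (1 - s) * (indicator (C i) x * (norm (x - c $ i))\<^sup>2)
          + s * (indicator (C i) x * (norm (x - d $ i))\<^sup>2) \<partial>P)"
    proof (rule integral_mono)
      fix x
      have "x - ((1 - s) *\<^sub>R c + s *\<^sub>R d) $ i = (1 - s) *\<^sub>R (x - c $ i) + s *\<^sub>R (x - d $ i)"
        by (simp add: algebra_simps)
      then show "indicator (C i) x * (norm (x - ((1 - s) *\<^sub>R c + s *\<^sub>R d) $ i))\<^sup>2
        \<le> (1 - s) * (indicator (C i) x * (norm (x - c $ i))\<^sup>2) + s * (indicator (C i) x * (norm (x - d $ i))\<^sup>2)"
        using norm_sq_convex[OF s, of "x - c $ i" "x - d $ i"] by (simp add: indicator_def)
    qed (intro Bochner_Integration.integrable_add integrable_mult_right integrable_indicator_sq C)+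
    also have "\<dots> = (1 - s) * (\<integral>x. indicator (C i) x * (norm (x - c $ i))\<^sup>2 \<partial>P)
        + s * (\<integral>x. indicator (C i) x * (norm (x - d $ i))\<^sup>2 \<partial>P)"
      by (subst Bochner_Integration.integral_add)
        (intro integrable_mult_right integrable_indicator_sq C | simp)+
    finally show ?thesis .
  qed
  then show ?thesis
    unfolding cost_def sum_distrib_left sum.distrib[symmetric] by (intro sum_mono)
qed

text \<open>A Lloyd step that sends the cells in Z to 0 instead of to their centroids.\<close>

lemma R_dist_centroid_step:
  fixes c d :: "'a ^ 'k::finite"
  assumes C: "voronoi_partition c C"
    and Z: "\<And>i. i \<in> Z \<Longrightarrow> d $ i = 0"
    and d: "\<And>i. i \<notin> Z \<Longrightarrow> has_vec_integral P (\<lambda>x. indicator (C i) x *\<^sub>R x) (prob (C i) *\<^sub>R d $ i)"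
    and s: "0 \<le> s" "s \<le> 1"
  shows "R_dist P ((1 - s) *\<^sub>R c + s *\<^sub>R d) \<le> R_dist P c + (\<Sum>i\<in>Z. M\<^sup>2 * prob (C i))"
proof -
  have Ci: "C i \<in> sets borel" for i using C by (simp add: voronoi_partition_def)
  have "(\<integral>x. indicator (C i) x * (norm (x - d $ i))\<^sup>2 \<partial>P)
      \<le> (\<integral>x. indicator (C i) x * (norm (x - c $ i))\<^sup>2 \<partial>P) + (if i \<in> Z then M\<^sup>2 * prob (C i) else 0)" for i
  proof (cases "i \<in> Z")
    case True
    \<comment> \<open>A codepoint at 0 costs \<open>(norm x)\<^sup>2\<close>, hence at most
      \<open>M\<^sup>2\<close> per unit of mass.\<close>
    have "(\<integral>x. indicator (C i) x * (norm (x - d $ i))\<^sup>2 \<partial>P) \<le> (\<integral>x. M\<^sup>2 * indicator (C i) x \<partial>P)"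
    proof (rule integral_mono_AE)
      show "AE x in P. indicator (C i) x * (norm (x - d $ i))\<^sup>2 \<le> M\<^sup>2 * indicator (C i) x"
        using AE_norm_le by eventually_elim (simp add: Z[OF True] indicator_def power_mono)
      show "integrable P (\<lambda>x. M\<^sup>2 * indicator (C i) x)"
        using Ci by (intro integrable_mult_right integrable_real_indicator) (simp_all add: sets_P emeasure_eq_measure)
    qed (rule integrable_indicator_sq[OF Ci])
    also have "\<dots> = M\<^sup>2 * prob (C i)" using Ci by (simp add: sets_P)
    finally have "(\<integral>x. indicator (C i) x * (norm (x - d $ i))\<^sup>2 \<partial>P) \<le> M\<^sup>2 * prob (C i)" .
    moreover have "0 \<le> (\<integral>x. indicator (C i) x * (norm (x - c $ i))\<^sup>2 \<partial>P)"
      by (intro Bochner_Integration.integral_nonneg) simp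
    ultimately show ?thesis unfolding if_P[OF True] by linarith
  next
    case False
    then show ?thesis
      using centroid_cost[OF Ci d[OF False], of "c $ i"] by (simp add: measure_nonneg)
  qed
  then have "cost C d \<le> cost C c + (\<Sum>i\<in>UNIV. if i \<in> Z then M\<^sup>2 * prob (C i) else 0)"
    unfolding cost_def sum.distrib[symmetric] by (intro sum_mono)
  then have "cost C d \<le> cost C c + (\<Sum>i\<in>Z. M\<^sup>2 * prob (C i))"
    by (simp add: sum.If_cases)
  moreover have "0 \<le> (\<Sum>i\<in>Z. M\<^sup>2 * prob (C i))" by (intro sum_nonneg) simp
  ultimately have "cost C d \<le> cost C c + (\<Sum>i\<in>Z. M\<^sup>2 * prob (C i))"
    "cost C c \<le> cost C c + (\<Sum>i\<in>Z. M\<^sup>2 * prob (C i))" by auto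
  then have "(1 - s) * cost C c + s * cost C d
      \<le> (1 - s) * (cost C c + (\<Sum>i\<in>Z. M\<^sup>2 * prob (C i))) + s * (cost C c + (\<Sum>i\<in>Z. M\<^sup>2 * prob (C i)))"
    using s by (intro add_mono mult_left_mono) auto
  also have "\<dots> = R_dist P c + (\<Sum>i\<in>Z. M\<^sup>2 * prob (C i))"
    by (simp add: R_dist_eq_cost[OF C] algebra_simps)
  finally show ?thesis
    using R_dist_le_cost[OF C, of "(1 - s) *\<^sub>R c + s *\<^sub>R d"] cost_convex[of s C c d, OF s Ci] by linarith
qed

text \<open>A barrier: a segment that leaves \<open>A\<close> must somewhere reach distortion
  \<open>K\<close>. Arbitrary segments are allowed because the property is applied both to Lloyd
  steps and to small perturbations of a minimizer.\<close>

definition segment_stable :: "('a ^ 'k::finite) set \<Rightarrow> real \<Rightarrow> bool" where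
  "segment_stable A K \<longleftrightarrow>
    (\<forall>c\<in>A. \<forall>d. (\<forall>s\<in>{0..1}. R_dist P ((1 - s) *\<^sub>R c + s *\<^sub>R d) < K) \<longrightarrow> d \<in> A)"

lemma segment_stableD:
  assumes "segment_stable A K" "c \<in> A"
    and "\<And>s. 0 \<le> s \<Longrightarrow> s \<le> 1 \<Longrightarrow> R_dist P ((1 - s) *\<^sub>R c + s *\<^sub>R d) < K"
  shows "d \<in> A"
  using assms unfolding segment_stable_def by simp

text \<open>Lloyd steps keep a minimizing sequence in A, and by compactness of the set of partial
  means they make it converge in norm, except for the codepoints of cells of vanishing mass, which
  are sent to 0.\<close>

lemma ex_R_dist_minimizer:
  fixes A :: "('a ^ 'k::{finite,linorder}) set"
  assumes A: "closed A" "c0 \<in> A" "R_dist P c0 < K"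
    and stable: "segment_stable A K"
  shows "\<exists>c\<in>A. \<forall>d\<in>A. R_dist P c \<le> R_dist P d"
proof -
  define m where "m = (INF c\<in>A. R_dist P c)"
  have bdd: "bdd_below (R_dist P ` A)"
    by (rule bdd_belowI2[of _ 0]) (rule R_dist_nonneg)
  have m_le: "m \<le> R_dist P c" if "c \<in> A" for c
    unfolding m_def by (rule cINF_lower[OF bdd that])
  have "\<exists>c\<in>A. R_dist P c < m + inverse (real (Suc n))" for n
  proof -
    have "m < m + inverse (real (Suc n))" by simp
    then show ?thesis unfolding m_def using cINF_less_iff[OF _ bdd] A(2) by blast
  qed
  then obtain X where XA: "X n \<in> A" and X: "R_dist P (X n) < m + inverse (real (Suc n))" for n
    by metis
  have Xm: "(\<lambda>n. R_dist P (X n)) \<longlonglongrightarrow> m"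
  proof (rule tendsto_sandwich[OF _ _ tendsto_const])
    show "(\<lambda>n. m + inverse (real (Suc n))) \<longlonglongrightarrow> m"
      by (rule LIMSEQ_inverse_real_of_nat_add)
    show "\<forall>\<^sub>F n in sequentially. R_dist P (X n) \<le> m + inverse (real (Suc n))"
      by (rule always_eventually) (rule allI, rule less_imp_le[OF X])
  qed (simp add: m_le XA)
  define C where "C n = tessellation (X n)" for n
  have C: "voronoi_partition (X n) (C n)" for n
    unfolding C_def by (rule voronoi_partition_tessellation)
  then have Cs: "C n i \<in> sets borel" for n i by (simp add: voronoi_partition_def)
  define u where "u n i = (SOME m. has_vec_integral P (\<lambda>x. indicator (C n i) x *\<^sub>R x) m)" for n i
  have u: "has_vec_integral P (\<lambda>x. indicator (C n i) x *\<^sub>R x) (u n i)" for n i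
    unfolding u_def by (rule someI_ex[OF ex_partial_mean[OF Cs]])
  define S where "S = closure {m. \<exists>W\<in>sets borel. has_vec_integral P (\<lambda>x. indicator W x *\<^sub>R x) m}"
  have uS: "u n i \<in> S" for n i
    unfolding S_def using u Cs by (intro subsetD[OF closure_subset] CollectI bexI)
  \<comment> \<open>Masses and partial means are made to converge along one common
    subsequence.\<close>
  have "compact ({0..1::real} \<times> S)"
    unfolding S_def by (intro compact_Times compact_Icc compact_partial_means)
  from finite_compact_subseq[OF finite_class.finite_UNIV this, of "\<lambda>n i. (prob (C n i), u n i)"] uS
  obtain r l where r: "strict_mono r"
    and l: "\<And>i. (\<lambda>n. (prob (C (r n) i), u (r n) i)) \<longlonglongrightarrow> l i"
    by force
  have p: "(\<lambda>n. prob (C (r n) i)) \<longlonglongrightarrow> fst (l i)" for i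
    using tendsto_fst[OF l[of i]] by simp
  have v: "(\<lambda>n. u (r n) i) \<longlonglongrightarrow> snd (l i)" for i
    using tendsto_snd[OF l[of i]] by simp
  \<comment> \<open>On these cells the quotient of mean and mass has a denominator tending to 0, so
    its convergence cannot be read off from the limits.\<close>
  define Z where "Z = {i. fst (l i) = 0}"
  define d where "d n = (\<chi> i. if i \<in> Z then 0 else inverse (prob (C (r n) i)) *\<^sub>R u (r n) i)" for n
  define y where "y = (\<chi> i. if i \<in> Z then 0 else inverse (fst (l i)) *\<^sub>R snd (l i))"
  have dy: "d \<longlonglongrightarrow> y"
  proof (rule vec_tendstoI)
    fix i
    have "(\<lambda>n. inverse (prob (C (r n) i)) *\<^sub>R u (r n) i) \<longlonglongrightarrow> inverse (fst (l i)) *\<^sub>R snd (l i)" if "i \<notin> Z"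
      using that by (intro tendsto_scaleR tendsto_inverse p v) (simp add: Z_def)
    then show "(\<lambda>n. d n $ i) \<longlonglongrightarrow> y $ i"
      by (cases "i \<in> Z") (simp_all add: d_def y_def)
  qed
  \<comment> \<open>Bounds the distortion on the whole segment from \<open>X (r n)\<close> to
    \<open>d n\<close>. The contribution of \<open>Z\<close> tends to 0, so \<open>b\<close> tends
    to \<open>m < K\<close> and \<open>segment_stable\<close> eventually applies.\<close>
  define b where "b n = R_dist P (X (r n)) + (\<Sum>i\<in>Z. M\<^sup>2 * prob (C (r n) i))" for n
  have "(\<lambda>n. R_dist P (X (r n))) \<longlonglongrightarrow> m"
    using LIMSEQ_subseq_LIMSEQ[OF Xm r] by (simp add: o_def)
  moreover have "(\<lambda>n. \<Sum>i\<in>Z. M\<^sup>2 * prob (C (r n) i)) \<longlonglongrightarrow> (\<Sum>i\<in>Z. M\<^sup>2 * fst (l i))"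
    by (intro tendsto_sum tendsto_mult tendsto_const p)
  ultimately have bm: "b \<longlonglongrightarrow> m"
    unfolding b_def using tendsto_add by (fastforce simp: Z_def)
  have "\<forall>\<^sub>F n in sequentially. \<forall>i\<in>- Z. prob (C (r n) i) > 0"
  proof (rule eventually_ball_finite)
    show "\<forall>i\<in>- Z. \<forall>\<^sub>F n in sequentially. prob (C (r n) i) > 0"
    proof
      fix i assume "i \<in> - Z"
      moreover have "0 \<le> fst (l i)"
        by (rule LIMSEQ_le_const[OF p]) (simp add: measure_nonneg)
      ultimately have "0 < fst (l i)" by (simp add: Z_def)
      then show "\<forall>\<^sub>F n in sequentially. prob (C (r n) i) > 0" by (rule order_tendstoD(1)[OF p])
    qed
  qed simp
  then have step: "\<forall>\<^sub>F n in sequentially. \<forall>s. 0 \<le> s \<longrightarrow> s \<le> 1 \<longrightarrow>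
      R_dist P ((1 - s) *\<^sub>R X (r n) + s *\<^sub>R d n) \<le> b n"
  proof eventually_elim
    fix n assume pos: "\<forall>i\<in>- Z. prob (C (r n) i) > 0"
    show "\<forall>s. 0 \<le> s \<longrightarrow> s \<le> 1 \<longrightarrow> R_dist P ((1 - s) *\<^sub>R X (r n) + s *\<^sub>R d n) \<le> b n"
    proof (intro allI impI)
      fix s :: real assume "0 \<le> s" "s \<le> 1"
      then show "R_dist P ((1 - s) *\<^sub>R X (r n) + s *\<^sub>R d n) \<le> b n"
        unfolding b_def
      proof (intro R_dist_centroid_step[OF C])
        fix i assume "i \<notin> Z"
        with pos have "prob (C (r n) i) \<noteq> 0" by (metis ComplI less_irrefl)
        with \<open>i \<notin> Z\<close> have "prob (C (r n) i) *\<^sub>R d n $ i = u (r n) i" by (simp add: d_def)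
        then show "has_vec_integral P (\<lambda>x. indicator (C (r n) i) x *\<^sub>R x) (prob (C (r n) i) *\<^sub>R d n $ i)"
          using u by simp
      qed (simp_all add: d_def)
    qed
  qed
  have "m < K" using m_le[OF A(2)] A(3) by simp
  have dA: "\<forall>\<^sub>F n in sequentially. d n \<in> A"
    using step order_tendstoD(2)[OF bm \<open>m < K\<close>]
  proof eventually_elim
    fix n assume *: "\<forall>s. 0 \<le> s \<longrightarrow> s \<le> 1 \<longrightarrow> R_dist P ((1 - s) *\<^sub>R X (r n) + s *\<^sub>R d n) \<le> b n" "b n < K"
    show "d n \<in> A"
      by (rule segment_stableD[OF stable XA]) (use * in \<open>blast intro: le_less_trans\<close>)
  qed
  have Rd: "\<forall>\<^sub>F n in sequentially. R_dist P (d n) \<le> b n"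
    using step
  proof eventually_elim
    fix n assume "\<forall>s. 0 \<le> s \<longrightarrow> s \<le> 1 \<longrightarrow> R_dist P ((1 - s) *\<^sub>R X (r n) + s *\<^sub>R d n) \<le> b n"
    from this[rule_format, of 1] show "R_dist P (d n) \<le> b n" by simp
  qed
  have "y \<in> A" by (rule Lim_in_closed_set[OF A(1) dA _ dy]) simp
  moreover have "(\<lambda>n. R_dist P (d n)) \<longlonglongrightarrow> R_dist P y"
    using continuous_R_dist dy by (rule continuous_on_tendsto_compose) simp_all
  then have "R_dist P y \<le> m"
    by (rule tendsto_le[OF _ bm _ Rd, rotated]) simp
  ultimately show ?thesis using m_le by (intro bexI[of _ y] ballI) (auto intro: order_trans)
qed

text \<open>By continuity the distortion stays below \<open>K\<close> on a ball around
  \<open>c\<close>. The ball is convex, so stability puts all of it into \<open>A\<close>, and the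
  constrained minimum is an unconstrained local one.\<close>

lemma minimizer_centroidal:
  fixes A :: "('a ^ 'k::{finite,linorder}) set"
  assumes c: "c \<in> A" "R_dist P c < K" "\<And>d. d \<in> A \<Longrightarrow> R_dist P c \<le> R_dist P d"
    and stable: "segment_stable A K"
  shows "c \<in> centroidal P"
proof -
  have "open {d :: ('a, 'k) vec. R_dist P d < K}"
    by (intro open_Collect_less continuous_R_dist continuous_on_const)
  with c(2) obtain e where e: "e > 0" "ball c e \<subseteq> {d. R_dist P d < K}"
    unfolding open_contains_ball by blast
  have "R_dist P c \<le> R_dist P d" if d: "norm (d - c) < e" for d
  proof (rule c(3), rule segment_stableD[OF stable c(1)])
    fix s :: real assume "0 \<le> s" "s \<le> 1"
    moreover have "d \<in> ball c e" "c \<in> ball c e"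
      using d e(1) by (simp_all add: dist_norm norm_minus_commute)
    ultimately have "(1 - s) *\<^sub>R c + s *\<^sub>R d \<in> ball c e"
      using convexD_alt[OF convex_ball, of c c e d s] by simp
    then show "R_dist P ((1 - s) *\<^sub>R c + s *\<^sub>R d) < K" using e(2) by blast
  qed
  then show ?thesis
    unfolding centroidal_def
    using local_min_centroid[OF e(1) _ voronoi_partition_tessellation] by blast
qed

end

section \<open>Consequences of the margin condition\<close>

lemma margin_conditionD:
  fixes c :: "'a::{real_inner,complete_space} ^ 'k::finite"
  assumes "prob_space P" "margin_condition TYPE('k) P M r0" "c \<in> optimal P" "0 \<le> t" "t \<le> r0"
  shows "measure P (thickening (boundary c) t) \<le> cell_sep TYPE('k) P * p_min TYPE('k) P / (128 * M\<^sup>2) * t"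
proof -
  interpret prob_space P by fact
  have "measure P (thickening (boundary c) t) \<le> margin_mass TYPE('k) P t"
    unfolding margin_mass_def using assms(3) by (intro cSUP_upper bdd_aboveI[of _ 1]) auto
  also have "\<dots> \<le> cell_sep TYPE('k) P * p_min TYPE('k) P / (128 * M\<^sup>2) * t"
    using assms by (simp add: margin_condition_def)
  finally show ?thesis .
qed

lemma cell_sep_le:
  fixes c :: "'a::real_inner ^ 'k::finite"
  assumes "c \<in> optimal P" "i \<noteq> j"
  shows "cell_sep TYPE('k) P \<le> norm (c $ i - c $ j)"
  unfolding cell_sep_def using assms by (intro cInf_lower bdd_belowI[of _ 0]) auto

lemma p_min_le:
  fixes c :: "'a::real_inner ^ 'k::finite"
  assumes "c \<in> optimal P"
  shows "p_min TYPE('k) P \<le> measure P (voronoi c i)"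
  unfolding p_min_def using assms by (intro cInf_lower bdd_belowI[of _ 0]) auto

lemma card_ge_2_ex_neq:
  assumes "CARD('k::finite) \<ge> 2"
  shows "\<exists>j :: 'k. j \<noteq> i"
proof (rule ccontr)
  assume "\<not> ?thesis"
  then have "UNIV = {i}" by blast
  then have "CARD('k) = card {i}" by (rule arg_cong[where f = card])
  then show False using assms by simp
qed

lemma cell_sep_nonneg:
  assumes "c \<in> (optimal P :: ('a::real_inner ^ 'k::finite) set)" "CARD('k) \<ge> 2"
  shows "0 \<le> cell_sep TYPE('k) P"
proof -
  have "\<exists>i j :: 'k. i \<noteq> j"
    using card_ge_2_ex_neq[OF assms(2)] by metis
  then show ?thesis
    unfolding cell_sep_def using assms(1) by (intro cInf_greatest) auto
qed

lemma p_min_nonneg: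
  assumes "c \<in> (optimal P :: ('a::real_inner ^ 'k::finite) set)"
  shows "0 \<le> p_min TYPE('k) P"
  unfolding p_min_def using assms by (intro cInf_greatest) auto

context bounded_distribution
begin

text \<open>The defining identity of the mean is tested with \<open>v = m\<close>.\<close>

lemma norm_centroid_le:
  assumes A: "A \<in> sets borel" "prob A > 0"
    and m: "has_vec_integral P (\<lambda>x. indicator A x *\<^sub>R x) (prob A *\<^sub>R m)"
  shows "norm m \<le> M"
proof -
  have "prob A * (m \<bullet> m) = (\<integral>x. indicator A x * (x \<bullet> m) \<partial>P)"
    using m by (simp add: has_vec_integral_def)
  also have "\<dots> \<le> (\<integral>x. (M * norm m) * indicator A x \<partial>P)"
  proof (rule integral_mono_AE)
    show "AE x in P. indicator A x * (x \<bullet> m) \<le> M * norm m * indicator A x"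
      using AE_norm_le
    proof eventually_elim
      fix x :: 'a assume "norm x \<le> M"
      then have "norm x * norm m \<le> M * norm m" by (rule mult_right_mono) simp
      then show "indicator A x * (x \<bullet> m) \<le> M * norm m * indicator A x"
        using norm_cauchy_schwarz[of x m] by (simp add: indicator_def)
    qed
    show "integrable P (\<lambda>x. M * norm m * indicator A x)"
      using A by (intro integrable_mult_right integrable_real_indicator) (simp_all add: sets_P emeasure_eq_measure)
  qed (rule integrable_indicator_inner[OF A(1)])
  also have "\<dots> = prob A * (M * norm m)" using A by (simp add: sets_P)
  finally have "m \<bullet> m \<le> M * norm m" using A(2) by simp
  then show ?thesis using M_nonneg by (rule norm_le_of_inner_le)
qed

text \<open>The identity is an adequate permutation because a codebook and a nearby optimal one
  carry matching labels.\<close>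

lemma R_classif_le: "R_classif P C D \<le> prob (\<Union>j. C j \<inter> - D j)"
proof -
  have "R_classif P C D \<le> prob (\<Union>j. C (id j) \<inter> - D j)"
    unfolding R_classif_def
    by (rule cINF_lower[OF bdd_belowI2[of _ 0]]) (simp_all only: measure_nonneg mem_Collect_eq permutes_id)
  then show ?thesis by (simp only: id_apply)
qed

lemma closed_boundary: "closed (boundary (c :: 'a ^ 'k::finite))"
  using closed_thickening_boundary[of 0 c] by (simp add: thickening_0)

text \<open>At \<open>t = 0\<close> the margin condition makes the boundary a null set, so breaking
  ties removes no mass from a closed cell.\<close>

lemma p_min_le_cell:
  fixes c :: "'a ^ 'k::finite"
  assumes c: "c \<in> optimal P" and margin: "margin_condition TYPE('k) P M r0"
    and C: "voronoi_partition c C"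
  shows "p_min TYPE('k) P \<le> prob (C i)"
proof -
  have "prob (boundary c) \<le> 0"
    using margin_conditionD[OF prob_space_axioms margin c, of 0] margin
    by (simp add: thickening_0 margin_condition_def)
  moreover have "voronoi c i \<subseteq> C i \<union> boundary c"
  proof
    fix x assume x: "x \<in> voronoi c i"
    obtain j where "x \<in> C j" "x \<in> voronoi c j" using voronoi_partition_cell[OF C] by blast
    then show "x \<in> C i \<union> boundary c" using x by (cases "i = j") (auto simp: boundary_def)
  qed
  then have "prob (voronoi c i) \<le> prob (C i \<union> boundary c)"
    using C closed_boundary[of c] by (intro finite_measure_mono) (auto simp: sets_P voronoi_partition_def)
  moreover have "prob (C i \<union> boundary c) \<le> prob (C i) + prob (boundary c)"
    using C closed_boundary[of c] by (intro measure_Un_le) (auto simp: sets_P voronoi_partition_def)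
  ultimately show ?thesis using p_min_le[OF c, of i] by linarith
qed

end

section \<open>Quantitative estimates around the optimal codebooks\<close>

locale margin_distribution = bounded_distribution P M
  for P :: "'a::{real_inner,complete_space} measure" and M :: real +
  fixes K :: "'k::{finite,linorder} itself" and r0 B pm :: real
  assumes card: "CARD('k) \<ge> 2" and M_pos: "0 < M"
    and margin: "margin_condition TYPE('k) P M r0"
    and B_def: "B = cell_sep TYPE('k) P" and pm_def: "pm = p_min TYPE('k) P"
    and B_pos: "0 < B" and pm_pos: "0 < pm"
    and ex_optimal: "(optimal P :: ('a, 'k) vec set) \<noteq> {}"
begin

lemma r0_pos: "0 < r0"
  using margin by (simp add: margin_condition_def)

text \<open>Optimal codepoints are centroids, and \<open>pm > 0\<close> excludes null cells, whose
  codepoints would be unconstrained.\<close>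

lemma optimal_norm_le:
  assumes "c \<in> (optimal P :: ('a, 'k) vec set)"
  shows "norm (c $ i) \<le> M"
proof (rule norm_centroid_le)
  show "has_vec_integral P (\<lambda>x. indicator (tessellation c i) x *\<^sub>R x) (prob (tessellation c i) *\<^sub>R c $ i)"
    by (rule optimal_centroid[OF assms voronoi_partition_tessellation])
  show "prob (tessellation c i) > 0"
    using p_min_le_cell[OF assms margin voronoi_partition_tessellation, of i] pm_pos pm_def by simp
  show "tessellation c i \<in> sets borel"
    using voronoi_partition_tessellation[of c] by (simp add: voronoi_partition_def)
qed

lemma B_le: "c \<in> (optimal P :: ('a, 'k) vec set) \<Longrightarrow> i \<noteq> j \<Longrightarrow> B \<le> norm (c $ i - c $ j)"
  unfolding B_def by (rule cell_sep_le)

lemma B_le_2M: "B \<le> 2 * M"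
proof -
  obtain c where c: "c \<in> (optimal P :: ('a, 'k) vec set)" using ex_optimal by blast
  obtain i j :: 'k where "i \<noteq> j" using card_ge_2_ex_neq[OF card] by metis
  then have "B \<le> norm (c $ i - c $ j)" using B_le[OF c] by simp
  also have "\<dots> \<le> norm (c $ i) + norm (c $ j)" by (rule norm_triangle_ineq4)
  finally show ?thesis using optimal_norm_le[OF c, of i] optimal_norm_le[OF c, of j] by simp
qed

lemma margin_le:
  assumes "c \<in> (optimal P :: ('a, 'k) vec set)" "0 \<le> t" "t \<le> r0"
  shows "prob (thickening (boundary c) t) \<le> B * pm / (128 * M\<^sup>2) * t"
  using margin_conditionD[OF prob_space_axioms margin assms] by (simp add: B_def pm_def)

text \<open>The 2 M-neighbourhood of the boundary carries all the mass.\<close>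

lemma r0_less: "r0 < 2 * M"
proof (rule ccontr)
  assume "\<not> ?thesis"
  then have r0: "2 * M \<le> r0" by simp
  obtain c where c: "c \<in> (optimal P :: ('a, 'k) vec set)" using ex_optimal by blast
  have "AE x in P. x \<in> thickening (boundary c) (2 * M)"
    using AE_norm_le
  proof eventually_elim
    fix x :: 'a assume x: "norm x \<le> M"
    obtain i where i: "x \<in> voronoi c i" using ex_voronoi by blast
    obtain j where j: "j \<noteq> i" using card_ge_2_ex_neq[OF card] by blast
    have "(norm (x - c $ j))\<^sup>2 - (norm (x - c $ i))\<^sup>2 \<le> norm (c $ j - c $ i) * (2 * norm x + norm (c $ j) + norm (c $ i))"
      using norm_diff_sq_diff_le[of x "c $ j" "c $ i"] by simp
    also have "\<dots> \<le> norm (c $ j - c $ i) * (2 * (2 * M))"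
      using x optimal_norm_le[OF c, of i] optimal_norm_le[OF c, of j] by (intro mult_left_mono) auto
    finally have "(norm (x - c $ j))\<^sup>2 - (norm (x - c $ i))\<^sup>2 \<le> 2 * (2 * M) * norm (c $ i - c $ j)"
      by (simp add: norm_minus_commute mult.commute)
    then show "x \<in> thickening (boundary c) (2 * M)"
      using i j M_nonneg by (subst thickening_boundary_eq) auto
  qed
  then have "prob (thickening (boundary c) (2 * M)) = 1"
    using closed_thickening_boundary[of "2 * M" c] M_nonneg by (subst prob_eq_1) (auto simp: sets_P)
  \<comment> \<open>Impossible: with \<open>B \<le> 2 * M\<close> and \<open>pm \<le> 1\<close> the
    right-hand side is at most 1/32.\<close>
  then have "1 \<le> B * pm / (128 * M\<^sup>2) * (2 * M)"
    using margin_le[OF c _ r0] M_nonneg by simp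
  moreover have "pm \<le> 1"
    using p_min_le[OF c] prob_le_1 pm_def order_trans by blast
  then have "B * pm \<le> 2 * M * 1"
    using B_le_2M pm_pos M_nonneg by (intro mult_mono) auto
  then have "B * pm / (128 * M\<^sup>2) * (2 * M) \<le> 2 * M * 1 / (128 * M\<^sup>2) * (2 * M)"
    using M_nonneg by (intro mult_right_mono divide_right_mono) auto
  moreover have "2 * M * 1 / (128 * M\<^sup>2) * (2 * M) < 1"
    using M_pos by (simp add: power2_eq_square)
  ultimately show False by simp
qed

definition r :: real where "r = B * r0 / (4 * sqrt 2 * M)"

lemma r_pos: "0 < r"
  using B_pos r0_pos M_pos by (simp add: r_def)

text \<open>Ensures that codebooks within \<open>r\<close> of an optimal one have codepoints of norm
  at most \<open>2 * M\<close>, as \<open>cell_change_le\<close> requires.\<close>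

lemma r_less: "r < M"
proof -
  have "B * r0 < (2 * M) * (2 * M)"
    using B_le_2M r0_less B_pos r0_pos M_pos
    by (meson mult_le_less_imp_less less_imp_le)
  also have "\<dots> \<le> M * (4 * sqrt 2 * M)"
    using M_pos real_sqrt_ge_1_iff[of 2] by (simp add: mult_left_mono)
  finally show ?thesis
    unfolding r_def using M_pos by (subst pos_divide_less_eq) auto
qed

definition radius :: "('a, 'k) vec \<Rightarrow> ('a, 'k) vec \<Rightarrow> real" where
  "radius c cs = 4 * sqrt 2 * M / B * norm (c - cs)"

lemma radius_nonneg: "0 \<le> radius c cs"
  using M_nonneg B_pos by (simp add: radius_def)

lemma radius_le: "norm (c - cs) \<le> r \<Longrightarrow> radius c cs \<le> r0"
  using M_pos B_pos by (simp add: radius_def r_def field_simps)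

context
  fixes c cs :: "('a, 'k) vec"
  assumes cs: "cs \<in> optimal P" and near: "norm (c - cs) \<le> r"
begin

lemma near_norm_le: "norm (c $ l) \<le> 2 * M"
proof -
  have "norm (c $ l) \<le> norm (cs $ l) + norm ((c - cs) $ l)"
    using norm_triangle_ineq[of "cs $ l" "(c - cs) $ l"] by simp
  then show ?thesis
    using optimal_norm_le[OF cs, of l] Finite_Cartesian_Product.norm_nth_le[of "c - cs" l] near r_less by linarith
qed

text \<open>Both brackets in \<open>cell_change_le\<close> are nonnegative here, so each is bounded
  by the bound on their sum: one limits the gain from changing cells, the other places
  \<open>x\<close> near the boundary of \<open>cs\<close>.\<close>

lemma near_cell_change:
  assumes x: "norm x \<le> M" "x \<in> voronoi cs i" "x \<in> voronoi c j" "i \<noteq> j"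
  shows "x \<in> thickening (boundary cs) (radius c cs)"
    and "(norm (x - c $ i))\<^sup>2 - (norm (x - c $ j))\<^sup>2 \<le> 5 * sqrt 2 * M * norm (c - cs)"
proof -
  note ch = cell_change_le[OF x(4) x(1) near_norm_le optimal_norm_le[OF cs]]
  have ge: "(norm (x - c $ j))\<^sup>2 \<le> (norm (x - c $ i))\<^sup>2" "(norm (x - cs $ i))\<^sup>2 \<le> (norm (x - cs $ j))\<^sup>2"
    by (rule voronoi_sq_le[OF x(3)], rule voronoi_sq_le[OF x(2)])
  show "(norm (x - c $ i))\<^sup>2 - (norm (x - c $ j))\<^sup>2 \<le> 5 * sqrt 2 * M * norm (c - cs)"
    using ch ge by linarith
  have "(norm (x - cs $ j))\<^sup>2 - (norm (x - cs $ i))\<^sup>2 \<le> 5 * sqrt 2 * M * norm (c - cs)"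
    using ch ge by linarith
  \<comment> \<open>\<open>B\<close> cancels and the right-hand side is
    \<open>8 * sqrt 2 * M * norm (c - cs)\<close>, so 5 is rounded up to 8.\<close>
  also have "\<dots> \<le> 2 * radius c cs * B"
    using B_pos M_nonneg by (simp add: radius_def mult_right_mono)
  also have "\<dots> \<le> 2 * radius c cs * norm (cs $ i - cs $ j)"
    using B_le[OF cs x(4)] radius_nonneg by (intro mult_left_mono) auto
  finally show "x \<in> thickening (boundary cs) (radius c cs)"
    using x radius_nonneg by (subst thickening_boundary_eq) auto
qed

lemma near_margin: "prob (thickening (boundary cs) (radius c cs)) \<le> sqrt 2 * pm / (32 * M) * norm (c - cs)"
proof -
  have "prob (thickening (boundary cs) (radius c cs)) \<le> B * pm / (128 * M\<^sup>2) * radius c cs"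
    by (rule margin_le[OF cs radius_nonneg radius_le[OF near]])
  also have "\<dots> = sqrt 2 * pm / (32 * M) * norm (c - cs)"
    using B_pos M_pos by (simp add: radius_def field_simps power2_eq_square)
  finally show ?thesis .
qed

text \<open>Freezing the cells of cs costs at least pm times the squared distance, and only
  points near the boundary can gain from changing cells.\<close>

lemma near_R_dist_ge: "R_dist P cs + 11 / 16 * pm * (norm (c - cs))\<^sup>2 \<le> R_dist P c"
proof -
  define C where "C = tessellation cs"
  have C: "voronoi_partition cs C" unfolding C_def by (rule voronoi_partition_tessellation)
  then have Ci: "C i \<in> sets borel" for i by (simp add: voronoi_partition_def)
  define T where "T = thickening (boundary cs) (radius c cs)"
  define g where "g = 5 * sqrt 2 * M * norm (c - cs)"
  have g0: "0 \<le> g" using M_nonneg by (simp add: g_def)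
  have T: "T \<in> sets borel"
    unfolding T_def by (intro borel_closed closed_thickening_boundary radius_nonneg)
  have "pm * (norm (c - cs))\<^sup>2 = (\<Sum>i\<in>UNIV. pm * (norm ((c - cs) $ i))\<^sup>2)"
    by (simp add: norm_vec_def L2_set_def sum_nonneg sum_distrib_left)
  also have "\<dots> \<le> (\<Sum>i\<in>UNIV. prob (C i) * (norm (c $ i - cs $ i))\<^sup>2)"
    using p_min_le_cell[OF cs margin C] by (intro sum_mono) (simp add: pm_def mult_right_mono)
  also have "\<dots> = cost C c - cost C cs"
    unfolding cost_def sum_subtractf[symmetric] centroid_cost[OF Ci optimal_centroid[OF cs C], of _ "c $ _"]
    by (simp only: add_diff_cancel_left')
  finally have low: "R_dist P cs + pm * (norm (c - cs))\<^sup>2 \<le> cost C c"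
    by (simp add: R_dist_eq_cost[OF C])
  have intT: "integrable P (\<lambda>x. g * indicator T x)"
    using T by (intro integrable_mult_right integrable_real_indicator) (simp_all add: sets_P emeasure_eq_measure)
  have "cost C c \<le> (\<integral>x. (MIN j. (norm (x - c $ j))\<^sup>2) + g * indicator T x \<partial>P)"
    unfolding cost_eq_integral[OF C]
  proof (rule integral_mono_AE[OF integrable_cost[OF C] Bochner_Integration.integrable_add[OF integrable_Min intT]])
    show "AE x in P. (\<Sum>i\<in>UNIV. indicator (C i) x * (norm (x - c $ i))\<^sup>2)
        \<le> (MIN j. (norm (x - c $ j))\<^sup>2) + g * indicator T x"
      using AE_norm_le
    proof eventually_elim
      fix x :: 'a assume x: "norm x \<le> M"
      obtain i where i: "x \<in> C i" "x \<in> voronoi cs i" using voronoi_partition_cell[OF C] by blast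
      obtain j where j: "x \<in> voronoi c j" using ex_voronoi by blast
      have eq: "(\<Sum>i\<in>UNIV. indicator (C i) x * (norm (x - c $ i))\<^sup>2) = (norm (x - c $ i))\<^sup>2"
        using C i by (intro sum_indicator_partition) (simp_all add: voronoi_partition_def)
      have "(norm (x - c $ i))\<^sup>2 \<le> (norm (x - c $ j))\<^sup>2 + g * indicator T x"
      proof (cases "i = j")
        case False
        then show ?thesis using near_cell_change[OF x i(2) j False] by (simp add: T_def g_def)
      qed (use g0 in simp)
      then show "(\<Sum>i\<in>UNIV. indicator (C i) x * (norm (x - c $ i))\<^sup>2)
        \<le> (MIN j. (norm (x - c $ j))\<^sup>2) + g * indicator T x"
        unfolding eq Min_voronoi[OF j] .
    qed
  qed
  also have "\<dots> = R_dist P c + g * prob T"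
  proof -
    have "(\<integral>x. g * indicator T x \<partial>P) = g * prob T" using T by (simp add: sets_P)
    with Bochner_Integration.integral_add[OF integrable_Min[of c] intT] show ?thesis
      by (simp only: R_dist_def)
  qed
  finally have up: "cost C c \<le> R_dist P c + g * prob T" .
  have "g * prob T \<le> g * (sqrt 2 * pm / (32 * M) * norm (c - cs))"
    unfolding T_def by (rule mult_left_mono[OF near_margin g0])
  \<comment> \<open>\<open>5 * sqrt 2 * sqrt 2 / 32 = 5 / 16\<close>, which leaves the coefficient
    \<open>11 / 16\<close> of the lemma.\<close>
  also have "\<dots> = 5 / 16 * pm * (norm (c - cs))\<^sup>2"
    using M_pos by (simp add: g_def power2_eq_square)
  finally show ?thesis using low up by linarith
qed

lemma near_classif:
  assumes C: "voronoi_partition c C" and D: "voronoi_partition cs D"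
  shows "R_classif P C D \<le> sqrt 2 * pm / (32 * M) * norm (c - cs)"
proof -
  define T where "T = thickening (boundary cs) (radius c cs)"
  have T: "T \<in> sets borel"
    unfolding T_def by (intro borel_closed closed_thickening_boundary radius_nonneg)
  have "R_classif P C D \<le> prob (\<Union>j. C j \<inter> - D j)"
    by (rule R_classif_le)
  also have "\<dots> \<le> prob T"
  proof (rule finite_measure_mono_AE)
    show "AE x in P. x \<in> (\<Union>j. C j \<inter> - D j) \<longrightarrow> x \<in> T"
      using AE_norm_le
    proof (eventually_elim, intro impI)
      fix x :: 'a assume x: "norm x \<le> M" "x \<in> (\<Union>j. C j \<inter> - D j)"
      then obtain j where j: "x \<in> voronoi c j" "x \<notin> D j"
        using C by (auto simp: voronoi_partition_def)
      obtain i where i: "x \<in> D i" "x \<in> voronoi cs i" using voronoi_partition_cell[OF D] by blast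
      then have "i \<noteq> j" using j by auto
      then show "x \<in> T" unfolding T_def using near_cell_change(1)[OF x(1) i(2) j(1)] by simp
    qed
  qed (use T in \<open>simp add: sets_P\<close>)
  also have "\<dots> \<le> sqrt 2 * pm / (32 * M) * norm (c - cs)"
    unfolding T_def by (rule near_margin)
  finally show ?thesis .
qed

end

text \<open>Along a segment that enters the r-ball of an optimal codebook, the distortion reaches the
  value on its sphere; so Lloyd steps cannot enter, and a minimizer outside the balls is a local
  minimizer.\<close>

lemma near_optimal:
  fixes c cs :: "('a, 'k) vec"
  assumes cs: "cs \<in> optimal P"
    and sep: "separated TYPE('k) P e"
    and c: "R_dist P c - R_dist P cs \<le> pm * B\<^sup>2 * r0\<^sup>2 / (64 * M\<^sup>2)" "R_dist P c - R_dist P cs \<le> e"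
    and nc: "c \<notin> centroidal P - optimal P"
  shows "\<exists>c'\<in>optimal P. norm (c - c') < r"
proof (rule ccontr)
  assume neg: "\<not> ?thesis"
  define A where "A = {d :: ('a, 'k) vec. \<forall>c'\<in>optimal P. r \<le> norm (d - c')}"
  define K' where "K' = R_dist P cs + 11 / 16 * pm * r\<^sup>2"
  have opt_eq: "R_dist P c' = R_dist P cs" if "c' \<in> optimal P" for c' :: "('a, 'k) vec"
    using that cs by (auto simp: optimal_def intro: antisym)
  have cA: "c \<in> A" using neg by (auto simp: A_def not_less)
  have "pm * B\<^sup>2 * r0\<^sup>2 / (64 * M\<^sup>2) = 1 / 2 * pm * r\<^sup>2"
    using M_pos by (simp add: r_def power_divide power_mult_distrib)
  moreover have "0 < pm * r\<^sup>2" using pm_pos r_pos by simp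
  ultimately have cK: "R_dist P c < K'" using c(1) unfolding K'_def by linarith
  have stable: "segment_stable A K'"
    unfolding segment_stable_def
  proof (intro ballI allI impI)
    fix b d assume b: "b \<in> A" and seg: "\<forall>s\<in>{0..1}. R_dist P ((1 - s) *\<^sub>R b + s *\<^sub>R d) < K'"
    show "d \<in> A"
    proof (rule ccontr)
      assume "d \<notin> A"
      then obtain c' where c': "c' \<in> optimal P" "norm (d - c') < r" by (auto simp: A_def not_le)
      \<comment> \<open>The distance to \<open>c'\<close> is at least \<open>r\<close> at
        \<open>b\<close> and below \<open>r\<close> at \<open>d\<close>, so the segment meets the
        sphere.\<close>
      have "\<exists>s. 0 \<le> s \<and> s \<le> 1 \<and> norm ((1 - s) *\<^sub>R b + s *\<^sub>R d - c') = r"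
        using b c' by (intro IVT2') (auto simp: A_def intro!: continuous_intros)
      then obtain s where s: "0 \<le> s" "s \<le> 1" "norm ((1 - s) *\<^sub>R b + s *\<^sub>R d - c') = r" by blast
      have "K' \<le> R_dist P ((1 - s) *\<^sub>R b + s *\<^sub>R d)"
        using near_R_dist_ge[OF c'(1), of "(1 - s) *\<^sub>R b + s *\<^sub>R d"] s(3) by (simp add: K'_def opt_eq[OF c'(1)])
      then show False using bspec[OF seg, of s] s by simp
    qed
  qed
  have "closed A"
    unfolding A_def Ball_def
    by (intro closed_Collect_all closed_Collect_imp closed_Collect_le open_Collect_const continuous_intros)
  from ex_R_dist_minimizer[OF this cA cK stable]
  obtain y where y: "y \<in> A" "\<And>d. d \<in> A \<Longrightarrow> R_dist P y \<le> R_dist P d" by auto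
  have A_opt: "d \<notin> optimal P" if "d \<in> A" for d
    using that r_pos by (force simp: A_def)
  have yc: "R_dist P y \<le> R_dist P c" using y(2)[OF cA] .
  have "y \<in> centroidal P"
    by (rule minimizer_centroidal[OF y(1) le_less_trans[OF yc cK] y(2) stable])
  then have "y \<in> centroidal P - optimal P" using A_opt[OF y(1)] by simp
  then have "(INF d \<in> centroidal P - (optimal P :: ('a, 'k) vec set). ereal (R_dist P d - R_dist P cs))
      \<le> ereal (R_dist P y - R_dist P cs)"
    by (rule INF_lower)
  moreover have "ereal e \<le> (INF d \<in> centroidal P - (optimal P :: ('a, 'k) vec set). ereal (R_dist P d - R_dist P cs))"
    using sep cs by (simp add: separated_def)
  ultimately have "ereal e \<le> ereal (R_dist P y - R_dist P cs)"
    by (rule order_trans[rotated])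
  then have "e \<le> R_dist P y - R_dist P cs" by simp
  \<comment> \<open>Separation is not strict and still permits excess exactly \<open>e\<close>. In
    that borderline case \<open>c\<close> attains the minimum over \<open>A\<close> as well, hence
    is centroidal and not optimal, which \<open>nc\<close> excludes.\<close>
  then have "R_dist P c \<le> R_dist P d" if "d \<in> A" for d
    using y(2)[OF that] c(2) by simp
  then have "c \<in> centroidal P"
    by (rule minimizer_centroidal[OF cA cK _ stable])
  then show False using nc A_opt[OF cA] by blast
qed

end

theorem corollary3:
  fixes P :: "'a::{real_inner,complete_space} measure"
    and c cstar cnear :: "'a ^ 'k::{finite,linorder}"
    and C D :: "'k \<Rightarrow> 'a set"
    and M r0 \<epsilon> :: real
  assumes "CARD('k) \<ge> 2"
    and "M > 0"
    and "distribution P"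
    and "infinite (support P) \<or> card (support P) > CARD('k)"
    and "margin_condition TYPE('k) P M r0"
    and "\<epsilon> > 0" and "separated TYPE('k) P \<epsilon>"
    and "cstar \<in> optimal P"
    and "R_dist P c - R_dist P cstar
           \<le> min (p_min TYPE('k) P * (cell_sep TYPE('k) P)\<^sup>2 * r0\<^sup>2 / (64 * M\<^sup>2)) \<epsilon>"
    and "c \<notin> centroidal P - optimal P"
    and "is_arg_min (\<lambda>c'. norm (c - c')) (\<lambda>c'. c' \<in> optimal P) cnear"
    and "voronoi_partition c C" and "voronoi_partition cnear D"
  shows "R_classif P C D
           \<le> sqrt (p_min TYPE('k) P) / (16 * M) * sqrt (R_dist P c - R_dist P cstar)"
proof -
  define B where "B = cell_sep TYPE('k) P"
  define pm where "pm = p_min TYPE('k) P"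
  define E where "E = R_dist P c - R_dist P cstar"
  have near: "cnear \<in> optimal P" "\<And>d. d \<in> optimal P \<Longrightarrow> norm (c - cnear) \<le> norm (c - d)"
    using assms(11) by (auto simp: is_arg_min_def not_less)
  have eq: "R_dist P cnear = R_dist P cstar"
    using near(1) assms(8) by (auto simp: optimal_def intro: antisym)
  have "0 \<le> E" using assms(8) by (simp add: E_def optimal_def)
  have nonneg: "0 \<le> B" "0 \<le> pm"
    using cell_sep_nonneg[OF assms(8,1)] p_min_nonneg[OF assms(8)] by (simp_all add: B_def pm_def)
  have bdd: "bounded_distribution P M"
    using assms(3,5) by unfold_locales (simp_all add: margin_condition_def)
  interpret bounded_distribution P M by (rule bdd)
  show ?thesis
  proof (cases "B = 0 \<or> pm = 0")
    \<comment> \<open>Then the allowed excess is 0 and c is optimal, so positivity of B and pm need not be proved.\<close>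
    case True
    then have "E \<le> 0" using assms(9) by (auto simp: B_def pm_def E_def)
    then have "c \<in> optimal P"
      using assms(8) by (auto simp: E_def optimal_def intro: order_trans)
    then have "cnear = c" using near(2)[of c] by simp
    have "R_classif P C D \<le> prob (\<Union>j. C j \<inter> - D j)"
      by (rule R_classif_le)
    also have "\<dots> \<le> prob (boundary c)"
    proof (rule finite_measure_mono)
      show "boundary c \<in> events" using closed_boundary[of c] by (auto simp: sets_P)
      show "(\<Union>j. C j \<inter> - D j) \<subseteq> boundary c"
      proof
        fix x assume "x \<in> (\<Union>j. C j \<inter> - D j)"
        then obtain j where j: "x \<in> voronoi c j" "x \<notin> D j"
          using assms(12) by (auto simp: voronoi_partition_def)
        obtain i where "x \<in> D i" "x \<in> voronoi c i"
          using voronoi_partition_cell[OF assms(13)] \<open>cnear = c\<close> by blast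
        then show "x \<in> boundary c" using j by (auto simp: boundary_def)
      qed
    qed
    also have "\<dots> \<le> 0"
      using margin_conditionD[OF prob_space_axioms assms(5) \<open>c \<in> optimal P\<close>, of 0] assms(5)
      by (simp add: thickening_0 margin_condition_def)
    also have "\<dots> \<le> sqrt pm / (16 * M) * sqrt E"
      using nonneg \<open>0 \<le> E\<close> assms(2) by simp
    finally show ?thesis by (simp add: pm_def E_def)
  next
    case False
    interpret margin_distribution P M "TYPE('k)" r0 B pm
      using False nonneg assms by unfold_locales (auto simp: B_def pm_def)
    have "\<exists>c'\<in>optimal P. norm (c - c') < r"
      using assms by (intro near_optimal[of cstar \<epsilon>]) (simp_all add: B_def pm_def)
    then have r: "norm (c - cnear) \<le> r" using near(2) by force
    have "11 / 16 * pm * (norm (c - cnear))\<^sup>2 \<le> E"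
      using near_R_dist_ge[OF near(1) r] by (simp add: E_def eq)
    moreover have "0 \<le> pm * (norm (c - cnear))\<^sup>2" using nonneg by simp
    \<comment> \<open>Weakening \<open>11 / 16\<close> to \<open>1 / 2\<close> yields the stated
      constant: \<open>sqrt 2 / 32 * sqrt 2 = 1 / 16\<close>.\<close>
    ultimately have "pm * (norm (c - cnear))\<^sup>2 \<le> 2 * E" by linarith
    then have "sqrt pm * norm (c - cnear) \<le> sqrt 2 * sqrt E"
      using real_sqrt_le_mono[of "pm * (norm (c - cnear))\<^sup>2" "2 * E"] by (simp add: real_sqrt_mult)
    then have "sqrt 2 * sqrt pm / (32 * M) * (sqrt pm * norm (c - cnear)) \<le> sqrt 2 * sqrt pm / (32 * M) * (sqrt 2 * sqrt E)"
      using nonneg assms(2) by (intro mult_left_mono) auto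
    also have "\<dots> = (sqrt 2 * sqrt 2) * (sqrt pm * sqrt E) / (32 * M)"
      by (simp only: times_divide_eq_left times_divide_eq_right mult_ac)
    also have "\<dots> = sqrt pm / (16 * M) * sqrt E" by simp
    also have "sqrt 2 * sqrt pm / (32 * M) * (sqrt pm * norm (c - cnear))
        = sqrt 2 * (sqrt pm * sqrt pm) / (32 * M) * norm (c - cnear)"
      by (simp only: times_divide_eq_left times_divide_eq_right mult_ac)
    finally have "sqrt 2 * pm / (32 * M) * norm (c - cnear) \<le> sqrt pm / (16 * M) * sqrt E"
      using nonneg by simp
    with near_classif[OF near(1) r assms(12,13)] show ?thesis by (simp add: pm_def E_def)
  qed
qed

end
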